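(* Let $n\ge2$, let $X_1,\dots,X_n$ be infinite dimensional Hilbert spaces and $D_k\in\mathcal{B}(X_k)$. Then for every $A\in\mathcal{B}_n$, $$\bigcup_{k=1}^n\sigma_l(D_k)=\sigma_l(T_n^d(A))\cup\Delta,\qquad \Delta=\bigcup_{k=2}^{n}\Big\{\lambda\in\sigma_l(D_k):\ \alpha(D_k-\lambda)\le\sum_{s=1}^{k-1}\beta(D_s-\lambda)\Big\}.$$ In particular, if $\Delta=\emptyset$ then $\bigcup_{k=1}^n\sigma_l(D_k)=\sigma_l(T_n^d(A))$ for every $A\in\mathcal{B}_n$.
   Context: For a bounded operator $T$, $\alpha(T)=\dim\mathcal{N}(T)$, $\beta(T)=\operatorname{codim}\mathcal{R}(T)$, values in $\{0,1,\dots\}\cup\{\infty\}$, sums and comparisons taken in this extended set. $T$ is left invertible if $\alpha(T)=0$ and $\mathcal{R}(T)$ is closed and complemented; $\sigma_l(T)=\{\lambda\in\mathbb{C}:\lambda-T$ not left invertible$\}$. $\mathcal{B}_n$ is the set of tuples $A=(A_{ij})_{1\le i<j\le n}$, $A_{ij}\in\mathcal{B}(X_j,X_i)$; $T_n^d(A)$ is the upper triangular operator matrix on $X_1\oplus\cdots\oplus X_n$ with diagonal $D_1,\dots,D_n$, entries $A_{ij}$ above the diagonal and zeros below. *)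

theory Defs
  imports "HOL-Analysis.Analysis" "HOL-Library.Function_Algebras" "HOL-Library.Extended_Nat"
begin

class complex_hilbert = banach +
  fixes scaleC :: "complex \<Rightarrow> 'a \<Rightarrow> 'a"
    and cinner :: "'a \<Rightarrow> 'a \<Rightarrow> complex"
  assumes scaleC_add_right: "scaleC a (x + y) = scaleC a x + scaleC a y"
    and scaleC_add_left: "scaleC (a + b) x = scaleC a x + scaleC b x"
    and scaleC_scaleC: "scaleC a (scaleC b x) = scaleC (a * b) x"
    and scaleC_one: "scaleC 1 x = x"
    and scaleR_scaleC: "scaleR r x = scaleC (complex_of_real r) x"
    and cinner_add_right: "cinner x (y + z) = cinner x y + cinner x z"
    and cinner_scaleC_right: "cinner x (scaleC a y) = a * cinner x y"
    and cinner_commute: "cinner y x = cnj (cinner x y)"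
    and norm_cinner: "norm x = sqrt (Re (cinner x x))"

definition lsubspace :: "(complex \<Rightarrow> 'v::ab_group_add \<Rightarrow> 'v) \<Rightarrow> 'v set \<Rightarrow> 'v set \<Rightarrow> bool" where
  "lsubspace scal V S \<longleftrightarrow> S \<subseteq> V \<and> 0 \<in> S \<and> (\<forall>x\<in>S. \<forall>y\<in>S. x + y \<in> S)
     \<and> (\<forall>c. \<forall>x\<in>S. scal c x \<in> S)"

definition indep_mod :: "(complex \<Rightarrow> 'v::ab_group_add \<Rightarrow> 'v) \<Rightarrow> 'v set \<Rightarrow> 'v set \<Rightarrow> bool" where
  "indep_mod scal R F \<longleftrightarrow>
     (\<forall>c. (\<Sum>v\<in>F. scal (c v) v) \<in> R \<longrightarrow> (\<forall>v\<in>F. c v = 0))"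

definition codim :: "(complex \<Rightarrow> 'v::ab_group_add \<Rightarrow> 'v) \<Rightarrow> 'v set \<Rightarrow> 'v set \<Rightarrow> enat" where
  "codim scal V R = Sup {enat (card F) | F. finite F \<and> F \<subseteq> V \<and> indep_mod scal R F}"

definition ldim :: "(complex \<Rightarrow> 'v::ab_group_add \<Rightarrow> 'v) \<Rightarrow> 'v set \<Rightarrow> enat" where
  "ldim scal S = codim scal S {0}"

definition alpha :: "(complex \<Rightarrow> 'v::ab_group_add \<Rightarrow> 'v) \<Rightarrow> 'v set \<Rightarrow> ('v \<Rightarrow> 'v) \<Rightarrow> enat" where
  "alpha scal V T = ldim scal {x \<in> V. T x = 0}"

definition beta :: "(complex \<Rightarrow> 'v::ab_group_add \<Rightarrow> 'v) \<Rightarrow> 'v set \<Rightarrow> ('v \<Rightarrow> 'v) \<Rightarrow> enat" where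
  "beta scal V T = codim scal V (T ` V)"

definition closed_sp :: "('v::ab_group_add \<Rightarrow> real) \<Rightarrow> 'v set \<Rightarrow> 'v set \<Rightarrow> bool" where
  "closed_sp nrm V S \<longleftrightarrow>
     (\<forall>u x. (\<forall>k. u k \<in> S) \<longrightarrow> x \<in> V \<longrightarrow> (\<lambda>k. nrm (u k - x)) \<longlonglongrightarrow> 0 \<longrightarrow> x \<in> S)"

definition left_inv :: "(complex \<Rightarrow> 'v::ab_group_add \<Rightarrow> 'v) \<Rightarrow> ('v \<Rightarrow> real) \<Rightarrow> 'v set \<Rightarrow> ('v \<Rightarrow> 'v) \<Rightarrow> bool" where
  "left_inv scal nrm V T \<longleftrightarrow>
     alpha scal V T = 0 \<and> closed_sp nrm V (T ` V) \<and>
     (\<exists>M. lsubspace scal V M \<and> closed_sp nrm V M \<and> T ` V \<inter> M = {0}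
          \<and> {r + m | r m. r \<in> T ` V \<and> m \<in> M} = V)"

definition lspec :: "(complex \<Rightarrow> 'v::ab_group_add \<Rightarrow> 'v) \<Rightarrow> ('v \<Rightarrow> real) \<Rightarrow> 'v set \<Rightarrow> ('v \<Rightarrow> 'v) \<Rightarrow> complex set" where
  "lspec scal nrm V T = {z. \<not> left_inv scal nrm V (\<lambda>x. scal z x - T x)}"

definition csubspace :: "'h::complex_hilbert set \<Rightarrow> bool" where
  "csubspace S \<longleftrightarrow> lsubspace scaleC UNIV S"

definition blin_on :: "'h::complex_hilbert set \<Rightarrow> 'h set \<Rightarrow> ('h \<Rightarrow> 'h) \<Rightarrow> bool" where
  "blin_on V W T \<longleftrightarrow> T ` V \<subseteq> W
     \<and> (\<forall>x\<in>V. \<forall>y\<in>V. T (x + y) = T x + T y)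
     \<and> (\<forall>c. \<forall>x\<in>V. T (scaleC c x) = scaleC c (T x))
     \<and> (\<exists>C. \<forall>x\<in>V. norm (T x) \<le> C * norm x)"

definition dsum :: "(nat \<Rightarrow> 'h::complex_hilbert set) \<Rightarrow> nat \<Rightarrow> (nat \<Rightarrow> 'h) set" where
  "dsum X n = {x. \<forall>i. (i \<in> {1..n} \<longrightarrow> x i \<in> X i) \<and> (i \<notin> {1..n} \<longrightarrow> x i = 0)}"

definition dscal :: "complex \<Rightarrow> (nat \<Rightarrow> 'h::complex_hilbert) \<Rightarrow> (nat \<Rightarrow> 'h)" where
  "dscal c x = (\<lambda>i. scaleC c (x i))"

definition dnorm :: "nat \<Rightarrow> (nat \<Rightarrow> 'h::complex_hilbert) \<Rightarrow> real" where
  "dnorm n x = sqrt (\<Sum>i = 1..n. (norm (x i))\<^sup>2)"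

definition Tmat :: "nat \<Rightarrow> (nat \<Rightarrow> 'h::complex_hilbert \<Rightarrow> 'h) \<Rightarrow> (nat \<Rightarrow> nat \<Rightarrow> 'h \<Rightarrow> 'h)
                     \<Rightarrow> (nat \<Rightarrow> 'h) \<Rightarrow> (nat \<Rightarrow> 'h)" where
  "Tmat n D A x = (\<lambda>i. if i \<in> {1..n} then D i (x i) + (\<Sum>j \<in> {i<..n}. A i j (x j)) else 0)"

definition in_Bn :: "nat \<Rightarrow> (nat \<Rightarrow> 'h::complex_hilbert set) \<Rightarrow> (nat \<Rightarrow> nat \<Rightarrow> 'h \<Rightarrow> 'h) \<Rightarrow> bool" where
  "in_Bn n X A \<longleftrightarrow> (\<forall>i j. 1 \<le> i \<and> i < j \<and> j \<le> n \<longrightarrow> blin_on (X j) (X i) (A i j))"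

abbreviation sigma_l :: "'h::complex_hilbert set \<Rightarrow> ('h \<Rightarrow> 'h) \<Rightarrow> complex set" where
  "sigma_l V T \<equiv> lspec scaleC norm V T"

end

(* Fix lambda and write E_k = lambda - D_k, T = lambda - T_n^d(A). If all E_k are left invertible,
   back substitution shows that T is injective with closed range, and the direct sum of complements
   of the ranges of the E_k is a complement of the range of T.
   Conversely let T be left invertible. Solving T y + m = (x,0,...,0) for x in X_1 gives a linear map
   x |-> y with closed graph, hence bounded, and so E_1 is left invertible. For any k, a vector v of
   the kernel of E_k is mapped to the part (A_1k v, ..., A_(k-1)k v) of the k-th column; injectivity
   of T makes this injective modulo the range of the upper left corner of T on
   X_1 + ... + X_(k-1), whose codimension is at most the sum of the beta(E_s), s < k. Hence every k
   for which E_k is not left invertible is at least 2 and satisfies the inequality defining Delta. *)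
theory Submission
  imports Defs
begin

text \<open>A complement of the range of T need not split along the coordinates, so cutting it down
  to X_1 need not give a complement of the range of E_1. What survives is a left inverse. Column 1
  of T has E_1 as its only nonzero entry, so for x = E_1 v the solution y is (v,0,...,0), and x |->
  y_1 is a left inverse of E_1. Its boundedness makes its kernel closed, and this kernel is the
  complement sought. Hence the need for a closed graph theorem on a closed subspace, with values in
  finitely many coordinates. For k > 1 the column has entries above E_k and this argument stops. All
  that is extracted there is the inequality for alpha(E_k), which holds for every k once T is
  injective. It is a counting argument: an infinite beta makes it trivial, and otherwise finite sets
  spanning modulo the ranges replace quotient spaces, so that everything reduces to a homogeneous
  linear system with more unknowns than equations.\<close>

section \<open>A closed graph theorem\<close>

text \<open>By Baire, the closure of some sublevel set of \<open>p\<close> has interior, so \<open>p\<close> is bounded on a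
  set dense near 0; expanding a vector into a geometric series of such elements and using
  countable subadditivity bounds \<open>p\<close> everywhere.\<close>

lemma zabreiko:
  fixes S :: "'a::banach set" and p :: "'a \<Rightarrow> real"
  assumes S: "subspace S" "closed S"
    and p_nonneg: "\<And>x. x \<in> S \<Longrightarrow> 0 \<le> p x"
    and p_add: "\<And>x y. x \<in> S \<Longrightarrow> y \<in> S \<Longrightarrow> p (x + y) \<le> p x + p y"
    and p_scale: "\<And>r x. x \<in> S \<Longrightarrow> p (r *\<^sub>R x) = \<bar>r\<bar> * p x"
    and p_sums: "\<And>u x. (\<And>k. u k \<in> S) \<Longrightarrow> summable (\<lambda>k. p (u k)) \<Longrightarrow> u sums x \<Longrightarrow>
                   p x \<le> (\<Sum>k. p (u k))"
  shows "\<exists>C\<ge>0. \<forall>x\<in>S. p x \<le> C * norm x"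
proof -
  define A where "A m = {x \<in> S. p x \<le> real m}" for m
  have A_sub: "closure (A m) \<subseteq> S" for m
    by (rule closure_minimal) (auto simp: A_def S)
  have S_eq: "S = (\<Union>m. closure (A m))"
  proof
    show "S \<subseteq> (\<Union>m. closure (A m))"
    proof
      fix x assume "x \<in> S"
      moreover obtain m where "p x \<le> real m" using real_arch_simple by blast
      ultimately have "x \<in> A m" by (simp add: A_def)
      then show "x \<in> (\<Union>m. closure (A m))" using closure_subset by blast
    qed
    show "(\<Union>m. closure (A m)) \<subseteq> S" by (rule UN_least) (rule A_sub)
  qed
  have p0: "p 0 = 0"
    using p_scale[of 0 0] subspace_0[OF S(1)] by simp
  \<comment> \<open>Baire is applied inside \<open>S\<close>, which is completely metrizable as a
    closed set. Interiors are relative to \<open>S\<close>, which may have empty interior in the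
    whole space.\<close>
  have "\<exists>m. top_of_set S interior_of closure (A m) \<noteq> {}"
  proof (rule ccontr)
    assume *: "\<not> ?thesis"
    have "top_of_set S interior_of \<Union>(range (\<lambda>m. closure (A m))) = {}"
    proof (rule Baire_category_alt)
      show "completely_metrizable_space (top_of_set S) \<or>
            locally_compact_space (top_of_set S) \<and> regular_space (top_of_set S)"
        by (rule disjI1[OF completely_metrizable_space_closedin[OF
              completely_metrizable_space_euclidean S(2)[unfolded closed_closedin]]])
      show "closedin (top_of_set S) T \<and> top_of_set S interior_of T = {}"
        if "T \<in> range (\<lambda>m. closure (A m))" for T
        using that * closed_subset[OF A_sub closed_closure] by blast
    qed simp
    then have "top_of_set S interior_of S = {}" unfolding S_eq[symmetric] .
    moreover have "top_of_set S interior_of S = S"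
      using interior_of_topspace[of "top_of_set S"] by (simp only: topspace_euclidean_subtopology)
    ultimately show False using subspace_0[OF S(1)] by blast
  qed
  then obtain m x0 where x0: "x0 \<in> top_of_set S interior_of closure (A m)" by blast
  have "openin (top_of_set S) (top_of_set S interior_of closure (A m))" by simp
  then obtain r where r: "r > 0" "ball x0 r \<inter> S \<subseteq> closure (A m)" and x0S: "x0 \<in> S"
    using x0 interior_of_subset[of "top_of_set S" "closure (A m)"] A_sub[of m]
    unfolding openin_contains_ball by blast
  \<comment> \<open>With \<open>t = r / (2 * norm x)\<close> below, \<open>K * norm x\<close> is the
    bound \<open>2 * m / t\<close> for \<open>p\<close> of a difference of two elements of
    \<open>A m\<close> divided by \<open>t\<close>.\<close>
  define K where "K = 4 * real m / r"
  have K: "K \<ge> 0" using r by (simp add: K_def)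
  have approx: "\<exists>y\<in>S. p y \<le> K * norm x \<and> norm (x - y) \<le> norm x / 2" if x: "x \<in> S" for x
  proof (cases "x = 0")
    case True
    then show ?thesis using x p0 by (intro bexI[of _ 0]) auto
  next
    case False
    \<comment> \<open>This puts \<open>x0 + t *\<^sub>R x\<close> at distance \<open>r / 2\<close>
      from \<open>x0\<close>, inside the ball. The tolerance \<open>e\<close> below is such that two
      errors of size \<open>e\<close>, divided by \<open>t\<close>, add up to
      \<open>norm x / 2\<close>.\<close>
    define t where "t = r / (2 * norm x)"
    have t: "t > 0" using r False by (simp add: t_def)
    define e where "e = t * norm x / 4"
    have e: "e > 0" using t False by (simp add: e_def)
    have "x0 + t *\<^sub>R x \<in> ball x0 r \<inter> S"
      using r False t x x0S S(1) by (auto simp: dist_norm t_def subspace_add subspace_scale)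
    then obtain a where a: "a \<in> A m" "dist a (x0 + t *\<^sub>R x) < e"
      using r e closure_approachable by blast
    have "x0 \<in> ball x0 r \<inter> S" using r x0S by simp
    then obtain b where b: "b \<in> A m" "dist b x0 < e"
      using r e closure_approachable by blast
    \<comment> \<open>\<open>x0\<close> itself is only in the closure of \<open>A m\<close>, so
      \<open>p x0\<close> is not controlled. The difference of two nearby elements of
      \<open>A m\<close> cancels \<open>x0\<close> and approximates
      \<open>t *\<^sub>R x\<close>.\<close>
    define y where "y = (1 / t) *\<^sub>R (a - b)"
    have ab: "a \<in> S" "b \<in> S" "p a \<le> m" "p b \<le> m" using a b by (auto simp: A_def)
    have yS: "y \<in> S" using ab S(1) by (simp add: y_def subspace_diff subspace_scale)
    have "p (a - b) \<le> p a + p ((-1) *\<^sub>R b)"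
      using p_add[of a "(-1) *\<^sub>R b"] ab S(1) by (simp add: subspace_neg)
    also have "\<dots> \<le> 2 * real m" using ab p_scale[of b "-1"] by simp
    finally have "p y \<le> (1 / t) * (2 * real m)"
      using t ab S(1) p_scale[of "a - b" "1 / t"] by (simp add: y_def subspace_diff divide_right_mono)
    also have "\<dots> = K * norm x" using r False by (simp add: K_def t_def)
    finally have py: "p y \<le> K * norm x" .
    have "x - y = (1 / t) *\<^sub>R ((x0 + t *\<^sub>R x - a) - (x0 - b))"
      using t by (simp add: y_def algebra_simps)
    then have "norm (x - y) = (1 / t) * norm ((x0 + t *\<^sub>R x - a) - (x0 - b))"
      using t by simp
    also have "\<dots> \<le> (1 / t) * (e + e)"
      using t a b norm_triangle_ineq4[of "x0 + t *\<^sub>R x - a" "x0 - b"]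
      by (intro mult_left_mono) (auto simp: dist_norm norm_minus_commute)
    also have "\<dots> = norm x / 2" using t by (simp add: e_def)
    finally show ?thesis using yS py by blast
  qed
  then obtain g where g: "\<And>x. x \<in> S \<Longrightarrow> g x \<in> S \<and> p (g x) \<le> K * norm x \<and> norm (x - g x) \<le> norm x / 2"
    by metis
  have "p x \<le> 2 * K * norm x" if x: "x \<in> S" for x
  proof -
    \<comment> \<open>The remainders of successive approximation: each step at least halves the
      norm, and the subtracted terms \<open>u k\<close> telescope to \<open>x\<close>.\<close>
    define z where "z = rec_nat x (\<lambda>_ v. v - g v)"
    have z0: "z 0 = x" and zS: "\<And>k. z (Suc k) = z k - g (z k)" by (auto simp: z_def)
    have zin: "z k \<in> S" for k
      by (induction k) (use x g S(1) in \<open>auto simp: z0 zS subspace_diff\<close>)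
    have zn: "norm (z k) \<le> norm x * (1 / 2) ^ k" for k
    proof (induction k)
      case (Suc k)
      then show ?case using g[OF zin[of k]] by (simp add: zS)
    qed (simp add: z0)
    define u where "u k = g (z k)" for k
    have uS: "u k \<in> S" for k using g zin by (simp add: u_def)
    have part: "(\<Sum>k<N. u k) = x - z N" for N
      by (induction N) (auto simp: z0 zS u_def)
    have geo: "(\<lambda>k. c * (1 / 2 :: real) ^ k) sums (c * 2)" for c
      using sums_mult[OF geometric_sums[of "1/2::real"], of c] by simp
    have "z \<longlonglongrightarrow> 0"
      by (rule Lim_null_comparison[OF _ summable_LIMSEQ_zero[OF sums_summable[OF geo[of "norm x"]]]])
        (use zn in auto)
    then have sums: "u sums x"
      unfolding sums_def part using tendsto_diff[OF tendsto_const, of z 0 sequentially x] by simp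
    have bd: "p (u k) \<le> K * norm x * (1 / 2) ^ k" for k
    proof -
      have "p (u k) \<le> K * norm (z k)" using g zin by (simp add: u_def)
      also have "\<dots> \<le> K * (norm x * (1 / 2) ^ k)" using zn K by (intro mult_left_mono)
      finally show ?thesis by (simp add: mult.assoc)
    qed
    have sm: "summable (\<lambda>k. p (u k))"
      by (rule summable_comparison_test'[OF sums_summable[OF geo[of "K * norm x"]], of 0])
        (use bd p_nonneg uS in auto)
    have "p x \<le> (\<Sum>k. p (u k))" using p_sums uS sm sums by blast
    also have "\<dots> \<le> (\<Sum>k. K * norm x * (1 / 2) ^ k)"
      by (rule suminf_le[OF bd sm sums_summable[OF geo]])
    also have "\<dots> = 2 * K * norm x" using sums_unique[OF geo[of "K * norm x"]] by simp
    finally show ?thesis .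
  qed
  then show ?thesis using K by (intro exI[of _ "2 * K"]) auto
qed

text \<open>The sum of the norms of the coordinates is countably subadditive: if the values of this
  sum along a series are summable, the image series converges absolutely in each coordinate, and
  closedness of the graph identifies its sums with the coordinates of the image. The target is a
  finite family of coordinates because the direct sum is encoded as a set of functions on indices,
  with each coordinate in a Banach space.\<close>

lemma closed_graph_coordinatewise:
  fixes Y :: "'a::banach \<Rightarrow> 'i \<Rightarrow> 'b::banach"
  assumes S: "subspace S" "closed S" and I: "finite I"
    and Y_add: "\<And>x y i. x \<in> S \<Longrightarrow> y \<in> S \<Longrightarrow> i \<in> I \<Longrightarrow> Y (x + y) i = Y x i + Y y i"
    and Y_scale: "\<And>r x i. x \<in> S \<Longrightarrow> i \<in> I \<Longrightarrow> Y (r *\<^sub>R x) i = r *\<^sub>R Y x i"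
    and graph: "\<And>u x y. (\<And>k. u k \<in> S) \<Longrightarrow> x \<in> S \<Longrightarrow> u \<longlonglongrightarrow> x \<Longrightarrow>
      (\<And>i. i \<in> I \<Longrightarrow> (\<lambda>k. Y (u k) i) \<longlonglongrightarrow> y i) \<Longrightarrow> \<forall>i\<in>I. Y x i = y i"
  shows "\<exists>C\<ge>0. \<forall>x\<in>S. \<forall>i\<in>I. norm (Y x i) \<le> C * norm x"
proof -
  define p where "p x = (\<Sum>i\<in>I. norm (Y x i))" for x
  have "\<exists>C\<ge>0. \<forall>x\<in>S. p x \<le> C * norm x"
  proof (rule zabreiko[OF S])
    show "0 \<le> p x" for x by (simp add: p_def sum_nonneg)
    show "p (x + y) \<le> p x + p y" if "x \<in> S" "y \<in> S" for x y
      unfolding p_def sum.distrib[symmetric]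
      by (rule sum_mono) (simp add: Y_add that norm_triangle_ineq)
    show "p (r *\<^sub>R x) = \<bar>r\<bar> * p x" if "x \<in> S" for r x
      by (simp add: p_def Y_scale that sum_distrib_left)
    fix u x
    assume u: "\<And>k. u k \<in> S" and sm: "summable (\<lambda>k. p (u k))" and ux: "u sums x"
    have le: "norm (Y (u k) i) \<le> p (u k)" if "i \<in> I" for i k
      unfolding p_def using that I by (intro member_le_sum) auto
    have smi: "summable (\<lambda>k. norm (Y (u k) i))" if "i \<in> I" for i
      by (rule summable_comparison_test'[OF sm, of 0]) (use le that in auto)
    define y where "y i = (\<Sum>k. Y (u k) i)" for i
    define s where "s N = (\<Sum>k<N. u k)" for N
    have sS: "s N \<in> S" for N unfolding s_def using S(1) u by (intro subspace_sum)
    have s0: "Y 0 i = 0" if "i \<in> I" for i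
      using Y_scale[of 0 i 0] subspace_0[OF S(1)] that by simp
    have Ys: "Y (s N) i = (\<Sum>k<N. Y (u k) i)" if "i \<in> I" for N i
    proof (induction N)
      case 0
      then show ?case using s0 that by (simp add: s_def)
    next
      case (Suc N)
      then show ?case using Y_add[OF sS[of N] u[of N] that] by (simp add: s_def)
    qed
    have "s \<longlonglongrightarrow> x" using ux by (simp add: sums_def s_def[abs_def])
    moreover have "x \<in> S"
      using S(2) sS calculation closed_sequentially by blast
    moreover have "(\<lambda>N. Y (s N) i) \<longlonglongrightarrow> y i" if "i \<in> I" for i
      using summable_LIMSEQ[OF summable_norm_cancel[OF smi[OF that]]] that
      by (simp add: Ys y_def)
    ultimately have "\<forall>i\<in>I. Y x i = y i" using graph[of s x y] sS by blast
    then have "p x = (\<Sum>i\<in>I. norm (y i))" by (simp add: p_def)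
    also have "\<dots> \<le> (\<Sum>i\<in>I. \<Sum>k. norm (Y (u k) i))"
      unfolding y_def by (intro sum_mono summable_norm smi)
    also have "\<dots> = (\<Sum>k. p (u k))"
      unfolding p_def by (rule suminf_sum[symmetric]) (rule smi)
    finally show "p x \<le> (\<Sum>k. p (u k))" .
  qed
  moreover have "norm (Y x i) \<le> p x" if "i \<in> I" for i x
    unfolding p_def using that I by (intro member_le_sum) auto
  ultimately show ?thesis by (meson order_trans)
qed

section \<open>Complex linear algebra\<close>

interpretation scaleC: vector_space "scaleC :: complex \<Rightarrow> 'h::complex_hilbert \<Rightarrow> 'h"
  by unfold_locales (rule scaleC_add_right scaleC_add_left scaleC_scaleC scaleC_one)+

lemma csubspace_iff: "csubspace S \<longleftrightarrow> scaleC.subspace S"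
  by (auto simp: csubspace_def lsubspace_def scaleC.subspace_def)

lemma csubspace_imp_subspace: "csubspace S \<Longrightarrow> subspace S"
  by (auto simp: csubspace_iff scaleC.subspace_def subspace_def scaleR_scaleC)

lemma norm_scaleC: "norm (scaleC c x) = cmod c * norm (x :: 'h::complex_hilbert)"
proof -
  have "cinner (scaleC c x) (scaleC c x) = c * cnj c * cinner x x"
    using cinner_commute[of "scaleC c x" x] cinner_commute[of x x]
    by (simp add: cinner_scaleC_right)
  also have "c * cnj c = complex_of_real ((cmod c)\<^sup>2)"
    by (rule complex_norm_square[symmetric])
  finally show ?thesis by (simp add: norm_cinner real_sqrt_mult)
qed

text \<open>Gaussian elimination: an equation with a nonzero coefficient at \<open>w\<close> is used
  to remove the unknown \<open>w\<close> from all others, which lowers both cardinalities by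
  one.\<close>

lemma underdetermined_system:
  fixes c :: "'v \<Rightarrow> 'i \<Rightarrow> complex"
  assumes "finite J" "finite F" "card J < card F"
  shows "\<exists>a. (\<exists>v\<in>F. a v \<noteq> 0) \<and> (\<forall>i\<in>J. (\<Sum>v\<in>F. a v * c v i) = 0)"
  using assms
proof (induction J arbitrary: F c rule: finite_induct)
  case empty
  then obtain v where "v \<in> F" by fastforce
  then show ?case by (intro exI[of _ "\<lambda>_. 1"]) auto
next
  case (insert i J)
  show ?case
  proof (cases "\<forall>v\<in>F. c v i = 0")
    case True
    obtain a where "\<exists>v\<in>F. a v \<noteq> 0" "\<forall>i\<in>J. (\<Sum>v\<in>F. a v * c v i) = 0"
      using insert.IH[of F c] insert.prems insert.hyps by auto
    then show ?thesis using True by (intro exI[of _ a]) auto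
  next
    case False
    then obtain w where w: "w \<in> F" "c w i \<noteq> 0" by blast
    define F' where "F' = F - {w}"
    have F: "finite F'" "F = insert w F'" "w \<notin> F'" using w insert.prems by (auto simp: F'_def)
    then have "card J < card F'" using insert.prems insert.hyps by simp
    then obtain a where a: "\<exists>v\<in>F'. a v \<noteq> 0"
      "\<And>j. j \<in> J \<Longrightarrow> (\<Sum>v\<in>F'. a v * (c v j - c v i / c w i * c w j)) = 0"
      using insert.IH[of F' "\<lambda>v j. c v j - c v i / c w i * c w j"] F by auto
    define s where "s = (\<Sum>v\<in>F'. a v * c v i)"
    \<comment> \<open>The value at \<open>w\<close> is the one that makes equation \<open>i\<close>
      hold; substituted into equation \<open>j\<close>, it yields the reduced equation solved by
      \<open>a\<close>.\<close>
    define b where "b = a(w := - s / c w i)"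
    have sum_b: "(\<Sum>v\<in>F. b v * c v j) = (\<Sum>v\<in>F'. a v * c v j) - s / c w i * c w j" for j
      unfolding F(2) using F by (simp add: b_def cong: sum.cong_simp) (auto intro!: sum.cong)
    have "(\<Sum>v\<in>F. b v * c v j) = 0" if "j \<in> insert i J" for j
    proof (cases "j = i")
      case True
      then show ?thesis using w by (simp add: sum_b s_def)
    next
      case False
      then have "(\<Sum>v\<in>F'. a v * c v j) - (\<Sum>v\<in>F'. a v * c v i / c w i * c w j) = 0"
        using a(2)[of j] that by (simp add: algebra_simps sum_subtractf)
      then show ?thesis
        by (simp add: sum_b s_def sum_distrib_right sum_divide_distrib)
    qed
    moreover have "\<exists>v\<in>F. b v \<noteq> 0" using a(1) F by (auto simp: b_def)
    ultimately show ?thesis by blast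
  qed
qed

section \<open>Bounded operators between subspaces\<close>

lemma blin_on_0: "blin_on V W T \<Longrightarrow> csubspace V \<Longrightarrow> T 0 = 0"
  using scaleC.subspace_0[of V] unfolding blin_on_def csubspace_iff
  by (metis scaleC.scale_zero_left)

lemma blin_on_add: "blin_on V W T \<Longrightarrow> x \<in> V \<Longrightarrow> y \<in> V \<Longrightarrow> T (x + y) = T x + T y"
  by (auto simp: blin_on_def)

lemma blin_on_scaleC: "blin_on V W T \<Longrightarrow> x \<in> V \<Longrightarrow> T (scaleC c x) = scaleC c (T x)"
  by (auto simp: blin_on_def)

lemma blin_on_in: "blin_on V W T \<Longrightarrow> x \<in> V \<Longrightarrow> T x \<in> W"
  by (auto simp: blin_on_def)

lemma blin_on_diff:
  assumes "blin_on V W T" "csubspace V" "x \<in> V" "y \<in> V"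
  shows "T (x - y) = T x - T y"
  using blin_on_add[OF assms(1) subspace_diff[OF csubspace_imp_subspace[OF assms(2)] assms(3,4)] assms(4)]
  by simp

lemma blin_on_sum:
  assumes "blin_on V W T" "csubspace V" "\<And>i. i \<in> F \<Longrightarrow> v i \<in> V"
  shows "T (\<Sum>i\<in>F. scaleC (a i) (v i)) = (\<Sum>i\<in>F. scaleC (a i) (T (v i)))"
  using assms(3)
proof (induction F rule: infinite_finite_induct)
  case (insert i F)
  have "(\<Sum>i\<in>F. scaleC (a i) (v i)) \<in> V" "scaleC (a i) (v i) \<in> V"
    using insert.prems assms(2) unfolding csubspace_iff
    by (auto intro!: scaleC.subspace_sum scaleC.subspace_scale)
  then show ?case
    using insert assms by (simp add: blin_on_add blin_on_scaleC)
qed (use blin_on_0[OF assms(1,2)] in auto)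

lemma blin_on_uminus:
  assumes "csubspace W" "blin_on V W T"
  shows "blin_on V W (\<lambda>x. - T x)"
  using assms subspace_neg[OF csubspace_imp_subspace[OF assms(1)]]
  unfolding blin_on_def by auto

lemma blin_on_scaleC_diff:
  assumes V: "csubspace V" and T: "blin_on V V T"
  shows "blin_on V V (\<lambda>x. scaleC z x - T x)"
proof -
  have sub: "scaleC.subspace V" using V by (simp add: csubspace_iff)
  obtain C where C: "\<forall>x\<in>V. norm (T x) \<le> C * norm x" using T unfolding blin_on_def by blast
  have "norm (scaleC z x - T x) \<le> (cmod z + C) * norm x" if "x \<in> V" for x
    using norm_triangle_ineq4[of "scaleC z x" "T x"] C that
    by (fastforce simp: norm_scaleC algebra_simps)
  moreover have "scaleC z x - T x \<in> V" if "x \<in> V" for x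
    using that blin_on_in[OF T that] scaleC.subspace_diff[OF sub] scaleC.subspace_scale[OF sub] by blast
  ultimately show ?thesis
    unfolding blin_on_def
    by (intro conjI exI[of _ "cmod z + C"]) (auto simp: blin_on_add[OF T] blin_on_scaleC[OF T] scaleC.scale_right_distrib
        scaleC.scale_right_diff_distrib mult.commute)
qed

lemma blin_on_tendsto:
  assumes "blin_on V W T" "csubspace V" "\<And>k. u k \<in> V" "x \<in> V" "u \<longlonglongrightarrow> x"
  shows "(\<lambda>k. T (u k)) \<longlonglongrightarrow> T x"
proof -
  obtain C where C: "\<And>x. x \<in> V \<Longrightarrow> norm (T x) \<le> C * norm x"
    using assms(1) unfolding blin_on_def by blast
  have "norm (T (u k) - T x) \<le> C * norm (u k - x)" for k
    using C[OF subspace_diff[OF csubspace_imp_subspace[OF assms(2)] assms(3,4)]]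
      blin_on_diff[OF assms(1,2) assms(3,4)] by simp
  moreover have "(\<lambda>k. C * norm (u k - x)) \<longlonglongrightarrow> 0"
    using assms(5) by (intro tendsto_mult_right_zero tendsto_norm_zero) (simp add: LIM_zero)
  ultimately have "(\<lambda>k. T (u k) - T x) \<longlonglongrightarrow> 0"
    by (rule Lim_null_comparison[OF always_eventually[OF allI]])
  then show ?thesis by (rule LIM_zero_cancel)
qed

lemma blin_on_csubspace_range:
  assumes "csubspace V" "blin_on V W T"
  shows "csubspace (T ` V)"
proof -
  have V: "scaleC.subspace V" using assms(1) by (simp add: csubspace_iff)
  show ?thesis
    unfolding csubspace_iff
  proof (rule scaleC.subspaceI)
    show "0 \<in> T ` V" using blin_on_0[OF assms(2,1)] scaleC.subspace_0[OF V] by (metis imageI)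
    fix a b assume "a \<in> T ` V" "b \<in> T ` V"
    then obtain x y where "x \<in> V" "y \<in> V" "a = T x" "b = T y" by blast
    then show "a + b \<in> T ` V"
      using blin_on_add[OF assms(2)] scaleC.subspace_add[OF V] by (metis imageI)
  next
    fix c a assume "a \<in> T ` V"
    then obtain x where "x \<in> V" "a = T x" by blast
    then show "scaleC c a \<in> T ` V"
      using blin_on_scaleC[OF assms(2)] scaleC.subspace_scale[OF V] by (metis imageI)
  qed
qed

text \<open>The lower bound turns a convergent sequence of images into a Cauchy sequence of
  preimages. This is the source of closed ranges, for E_1 and, row by row, for the matrix.\<close>

lemma bounded_below_convergent:
  assumes "blin_on V W T" "csubspace V" "closed V" "\<And>x. x \<in> V \<Longrightarrow> norm x \<le> C * norm (T x)"
    and "\<And>k. u k \<in> V" "(\<lambda>k. T (u k)) \<longlonglongrightarrow> w"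
  shows "\<exists>x\<in>V. u \<longlonglongrightarrow> x"
proof -
  have "Cauchy u"
  proof (rule metric_CauchyI)
    fix e :: real assume e: "e > 0"
    \<comment> \<open>\<open>C\<close> is not known to be positive, and \<open>e / C'\<close> has to
      be.\<close>
    define C' where "C' = max C 1"
    have "Cauchy (\<lambda>k. T (u k))" using assms(6) LIMSEQ_imp_Cauchy by blast
    then obtain N where N: "\<And>k l. k \<ge> N \<Longrightarrow> l \<ge> N \<Longrightarrow> dist (T (u k)) (T (u l)) < e / C'"
      using metric_CauchyD[of "\<lambda>k. T (u k)" "e / C'"] e by (auto simp: C'_def)
    have "dist (u k) (u l) < e" if "k \<ge> N" "l \<ge> N" for k l
    proof -
      have "norm (u k - u l) \<le> C * norm (T (u k) - T (u l))"
        using assms(4)[of "u k - u l"] assms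
        by (simp add: blin_on_diff csubspace_imp_subspace subspace_diff)
      also have "\<dots> \<le> C' * norm (T (u k) - T (u l))"
        by (intro mult_right_mono) (auto simp: C'_def)
      also have "\<dots> < e"
        using N[OF that] by (simp add: dist_norm C'_def field_simps)
      finally show ?thesis by (simp add: dist_norm)
    qed
    then show "\<exists>N. \<forall>k\<ge>N. \<forall>l\<ge>N. dist (u k) (u l) < e" by blast
  qed
  then obtain x where "u \<longlonglongrightarrow> x" using Cauchy_convergent_iff convergent_def by blast
  then show ?thesis using assms(3,5) closed_sequentially by blast
qed

section \<open>Closedness, kernels and codimension in terms of the definitions\<close>

lemma closed_sp_norm_iff:
  assumes "S \<subseteq> V" "closed V"
  shows "closed_sp norm V S \<longleftrightarrow> closed S"
proof -
  have "(\<lambda>k. norm (u k - x)) \<longlonglongrightarrow> 0 \<longleftrightarrow> u \<longlonglongrightarrow> x" for u :: "nat \<Rightarrow> 'a" and x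
    by (simp add: tendsto_norm_zero_iff LIM_zero_iff)
  then have "closed_sp norm V S \<longleftrightarrow> (\<forall>u x. (\<forall>k. u k \<in> S) \<longrightarrow> x \<in> V \<longrightarrow> u \<longlonglongrightarrow> x \<longrightarrow> x \<in> S)"
    by (simp only: closed_sp_def)
  moreover have "x \<in> V" if "\<forall>k. u k \<in> S" "u \<longlonglongrightarrow> x" for u x
    using closed_sequentially[OF assms(2)] that assms(1) by (metis subsetD)
  ultimately show ?thesis unfolding closed_sequential_limits by (metis (no_types))
qed

text \<open>A nonzero kernel vector is an independent family of size one. Conversely, a family
  consisting of zero vectors is independent only if it is empty, as the coefficients 1 show. The
  scalar multiplication is left open so that the lemma serves both the spaces X_k and their direct
  sum.\<close>

lemma alpha_eq_0_iff:
  assumes "vector_space scal"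
  shows "alpha scal V T = 0 \<longleftrightarrow> (\<forall>x\<in>V. T x = 0 \<longrightarrow> x = 0)"
proof -
  interpret vector_space scal by fact
  define Q where "Q F \<longleftrightarrow> finite F \<and> F \<subseteq> {x \<in> V. T x = 0} \<and> indep_mod scal {0} F" for F
  have "alpha scal V T = Sup {enat (card F) | F. Q F}"
    by (simp only: alpha_def ldim_def codim_def Q_def)
  then have "alpha scal V T = 0 \<longleftrightarrow> (\<forall>a\<in>{enat (card F) | F. Q F}. a = 0)"
    using Sup_bot_conv(1)[of "{enat (card F) | F. Q F}"] by (simp add: bot_enat_def)
  also have "\<dots> \<longleftrightarrow> (\<forall>F. Q F \<longrightarrow> card F = 0)"
    by (auto simp: zero_enat_def)
  also have "\<dots> \<longleftrightarrow> (\<forall>F. Q F \<longrightarrow> F = {})"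
    by (metis Q_def card_0_eq)
  also have "\<dots> \<longleftrightarrow> (\<forall>x\<in>V. T x = 0 \<longrightarrow> x = 0)"
  proof (intro iffI ballI impI allI)
    fix x assume *: "\<forall>F. Q F \<longrightarrow> F = {}" and x: "x \<in> V" "T x = 0"
    show "x = 0"
    proof (rule ccontr)
      assume "x \<noteq> 0"
      then have "Q {x}" using x by (auto simp: Q_def indep_mod_def)
      then show False using * by blast
    qed
  next
    fix F assume *: "\<forall>x\<in>V. T x = 0 \<longrightarrow> x = 0"
      and F: "Q F"
    then have "v = 0" if "v \<in> F" for v using that by (auto simp: Q_def)
    then have "(\<Sum>v\<in>F. scal 1 v) \<in> {0}" by (simp add: sum.neutral)
    then have "\<forall>v\<in>F. (1::complex) = 0"
      using F unfolding Q_def indep_mod_def by (elim conjE allE[of _ "\<lambda>_. 1"]) simp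
    then show "F = {}" by auto
  qed
  finally show ?thesis .
qed

text \<open>A family of largest size among those independent modulo \<open>R\<close> spans modulo
  \<open>R\<close>, for otherwise a further vector could be adjoined. It plays the part of a basis
  of the quotient of \<open>V\<close> by \<open>R\<close>.\<close>

lemma codim_finite_imp_spanning:
  fixes R :: "'h::complex_hilbert set"
  assumes V: "csubspace V" and R: "csubspace R" and fin: "codim scaleC V R \<noteq> \<infinity>"
  shows "\<exists>G. finite G \<and> G \<subseteq> V \<and> enat (card G) \<le> codim scaleC V R \<and>
    (\<forall>v\<in>V. \<exists>r\<in>R. \<exists>c. v - r = (\<Sum>g\<in>G. scaleC (c g) g))"
proof -
  let ?P = "\<lambda>G. finite G \<and> G \<subseteq> V \<and> indep_mod scaleC R G"
  obtain b where b: "codim scaleC V R = enat b" using fin by auto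
  have le: "enat (card G) \<le> codim scaleC V R" if "?P G" for G
    unfolding codim_def using that by (intro Sup_upper) blast
  have "?P {}" by (simp add: indep_mod_def)
  moreover have "\<forall>G. ?P G \<longrightarrow> card G < Suc b"
    using le unfolding b by (auto simp: less_Suc_eq_le)
  ultimately obtain G where G: "?P G" and max: "\<And>G'. ?P G' \<Longrightarrow> card G' \<le> card G"
    using ex_has_greatest_nat[of ?P "{}" card "Suc b"] by blast
  have "\<exists>r\<in>R. \<exists>c. v - r = (\<Sum>g\<in>G. scaleC (c g) g)" if v: "v \<in> V" for v
  proof (cases "v \<in> G")
    case True
    have "v - 0 = (\<Sum>g\<in>G. scaleC (if g = v then 1 else 0) g)"
      using True G by (simp add: if_distrib[of "\<lambda>c. scaleC c _"] cong: if_cong)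
    moreover have "0 \<in> R" using R unfolding csubspace_iff by (rule scaleC.subspace_0)
    ultimately show ?thesis by (intro bexI[of _ 0] exI)
  next
    case False
    then have "\<not> ?P (insert v G)" using max[of "insert v G"] G by auto
    then have "\<not> indep_mod scaleC R (insert v G)" using G v by auto
    then obtain c where c: "(\<Sum>g\<in>insert v G. scaleC (c g) g) \<in> R" "\<exists>g\<in>insert v G. c g \<noteq> 0"
      by (auto simp: indep_mod_def)
    have sum: "scaleC (c v) v + (\<Sum>g\<in>G. scaleC (c g) g) \<in> R" using c G False by simp
    \<comment> \<open>Otherwise the relation would involve \<open>G\<close> alone, which is
      independent modulo \<open>R\<close>. So the relation can be solved for
      \<open>v\<close>.\<close>
    have cv: "c v \<noteq> 0"
    proof
      assume "c v = 0"
      then show False using sum c(2) G by (auto simp: indep_mod_def)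
    qed
    define r where "r = scaleC (1 / c v) (scaleC (c v) v + (\<Sum>g\<in>G. scaleC (c g) g))"
    have "r \<in> R" using sum R unfolding r_def csubspace_iff by (intro scaleC.subspace_scale)
    moreover have "v - r = (\<Sum>g\<in>G. scaleC (- c g / c v) g)"
      using cv by (simp add: r_def scaleC.scale_right_distrib scaleC.scale_sum_right
          sum_negf[symmetric] del: sum_negf)
    ultimately show ?thesis by (intro bexI[of _ r] exI[of _ "\<lambda>g. - c g / c v"])
  qed
  then show ?thesis using G le by blast
qed

section \<open>Left invertible operators and their left inverses\<close>

lemma left_inv_cong:
  assumes "\<And>x. x \<in> V \<Longrightarrow> S x = T x"
  shows "left_inv scal nrm V S \<longleftrightarrow> left_inv scal nrm V T"
proof -
  have "S ` V = T ` V" using assms by (intro image_cong) auto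
  moreover have "{x \<in> V. S x = 0} = {x \<in> V. T x = 0}" using assms by auto
  ultimately show ?thesis by (simp only: left_inv_def alpha_def)
qed

text \<open>\<open>U\<close> is the projection onto the range of \<open>T\<close> along the
  complement \<open>M\<close>, followed by the inverse of \<open>T\<close>. Since \<open>T\<close>
  is injective and its range meets \<open>M\<close> only in 0, the condition
  \<open>x - T u \<in> M\<close> determines \<open>u\<close>, and linearity of \<open>U\<close>
  follows from this uniqueness alone. Boundedness is left to the closed graph theorem, whose
  hypothesis is immediate from the closedness of \<open>M\<close>.\<close>

lemma left_inv_solution:
  assumes "vector_space scal" and V: "lsubspace scal V V"
    and T_in: "\<forall>x\<in>V. T x \<in> V"
    and T_add: "\<forall>x\<in>V. \<forall>y\<in>V. T (x + y) = T x + T y"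
    and T_scale: "\<forall>c. \<forall>x\<in>V. T (scal c x) = scal c (T x)"
    and left_inv: "left_inv scal nrm V T"
  shows "\<exists>M U. lsubspace scal V M \<and> closed_sp nrm V M \<and>
    (\<forall>x\<in>V. U x \<in> V \<and> x - T (U x) \<in> M) \<and>
    (\<forall>x\<in>V. \<forall>u\<in>V. x - T u \<in> M \<longrightarrow> U x = u) \<and>
    (\<forall>x\<in>V. \<forall>y\<in>V. U (x + y) = U x + U y) \<and>
    (\<forall>c. \<forall>x\<in>V. U (scal c x) = scal c (U x))"
proof -
  interpret vector_space scal by fact
  have sub: "subspace V" using V by (auto simp: lsubspace_def subspace_def)
  obtain M where M: "lsubspace scal V M" "closed_sp nrm V M" "T ` V \<inter> M = {0}"
    and sum: "{r + m | r m. r \<in> T ` V \<and> m \<in> M} = V"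
    using left_inv by (auto simp: left_inv_def)
  have subM: "subspace M" using M(1) by (auto simp: lsubspace_def subspace_def)
  have "\<exists>u\<in>V. x - T u \<in> M" if "x \<in> V" for x
  proof -
    have "x \<in> {r + m | r m. r \<in> T ` V \<and> m \<in> M}" using that sum by simp
    then obtain u m where "u \<in> V" "m \<in> M" "x = T u + m" by blast
    then show ?thesis by (intro bexI[of _ u]) auto
  qed
  then obtain U where U: "\<And>x. x \<in> V \<Longrightarrow> U x \<in> V" "\<And>x. x \<in> V \<Longrightarrow> x - T (U x) \<in> M"
    by metis
  have T_diff: "T (x - y) = T x - T y" if "x \<in> V" "y \<in> V" for x y
    using T_add[rule_format, of "x - y" y] that subspace_diff[OF sub that] by simp
  have unique: "U x = u" if "x \<in> V" "u \<in> V" "x - T u \<in> M" for x u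
  proof -
    have "(x - T u) - (x - T (U x)) \<in> M" using that U subM subspace_diff by blast
    then have "T (U x - u) \<in> M" using that U by (simp add: T_diff)
    moreover have "U x - u \<in> V" using that U sub subspace_diff by blast
    ultimately have "T (U x - u) = 0" using M(3) by blast
    then have "U x - u = 0"
      using left_inv \<open>U x - u \<in> V\<close> by (auto simp: left_inv_def alpha_eq_0_iff[OF assms(1)])
    then show ?thesis by simp
  qed
  have "U (x + y) = U x + U y" if "x \<in> V" "y \<in> V" for x y
  proof (rule unique)
    have "(x - T (U x)) + (y - T (U y)) \<in> M" using that U subM subspace_add by blast
    then show "x + y - T (U x + U y) \<in> M" using that U by (simp add: T_add algebra_simps)
  qed (use that U sub subspace_add in blast)+
  moreover have "U (scal c x) = scal c (U x)" if "x \<in> V" for c x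
  proof (rule unique)
    have "scal c (x - T (U x)) \<in> M" using that U subM subspace_scale by blast
    then show "scal c x - T (scal c (U x)) \<in> M"
      using that U by (simp add: T_scale scale_right_diff_distrib)
  qed (use that U sub subspace_scale in blast)+
  ultimately show ?thesis using M(1,2) U unique by (intro exI[of _ M] exI[of _ U]) simp
qed

text \<open>The solution operator \<open>U\<close> satisfies \<open>U (T x) = x\<close>, because the
  residual 0 lies in \<open>M\<close>. A bound for \<open>U\<close> is therefore a lower bound for
  \<open>T\<close>.\<close>

lemma left_inv_bounded_below:
  fixes T :: "'h::complex_hilbert \<Rightarrow> 'h"
  assumes V: "csubspace V" "closed V" and T: "blin_on V V T" and "left_inv scaleC norm V T"
  shows "\<exists>C\<ge>0. \<forall>x\<in>V. norm x \<le> C * norm (T x)"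
proof -
  have VV: "lsubspace scaleC V V" using V by (auto simp: csubspace_def lsubspace_def)
  have T': "\<forall>x\<in>V. T x \<in> V" "\<forall>x\<in>V. \<forall>y\<in>V. T (x + y) = T x + T y"
    "\<forall>c. \<forall>x\<in>V. T (scaleC c x) = scaleC c (T x)"
    using T by (auto simp: blin_on_def)
  obtain M U where M: "lsubspace scaleC V M" "closed_sp norm V M"
    and U: "\<forall>x\<in>V. U x \<in> V \<and> x - T (U x) \<in> M"
    and unique: "\<forall>x\<in>V. \<forall>u\<in>V. x - T u \<in> M \<longrightarrow> U x = u"
    and U_add: "\<forall>x\<in>V. \<forall>y\<in>V. U (x + y) = U x + U y"
    and U_scale: "\<forall>c. \<forall>x\<in>V. U (scaleC c x) = scaleC c (U x)"
    using left_inv_solution[where T = T, OF scaleC.vector_space_axioms VV T'(1,2,3) assms(4)]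
    by (elim exE conjE) (rule that)
  have MV: "M \<subseteq> V" "0 \<in> M" using M by (auto simp: lsubspace_def)
  have "closed M" using M(2) closed_sp_norm_iff[OF MV(1) V(2)] by simp
  \<comment> \<open>A single target space is the case of one coordinate, indexed by the unit
    element.\<close>
  have "\<exists>C\<ge>0. \<forall>x\<in>V. \<forall>i\<in>{()}. norm (U x) \<le> C * norm x"
  proof (rule closed_graph_coordinatewise[of V "{()}" "\<lambda>x _. U x"])
    show "subspace V" "closed V" using V csubspace_imp_subspace by auto
    fix u x y
    assume u: "\<And>k. u k \<in> V" and x: "x \<in> V" "u \<longlonglongrightarrow> x"
      and y: "\<And>i. i \<in> {()} \<Longrightarrow> (\<lambda>k. U (u k)) \<longlonglongrightarrow> y i"
    have y': "(\<lambda>k. U (u k)) \<longlonglongrightarrow> y ()" using y by simp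
    have Uu: "U (u k) \<in> V" "u k - T (U (u k)) \<in> M" for k using U u by auto
    have yV: "y () \<in> V" by (rule closed_sequentially[OF V(2) Uu(1) y'])
    have "(\<lambda>k. u k - T (U (u k))) \<longlonglongrightarrow> x - T (y ())"
      by (intro tendsto_diff x blin_on_tendsto[OF T V(1) Uu(1) yV y'])
    then have "x - T (y ()) \<in> M" by (rule closed_sequentially[OF \<open>closed M\<close> Uu(2)])
    then show "\<forall>i\<in>{()}. U x = y i" using unique x(1) yV by simp
  qed (auto simp: U_add U_scale scaleR_scaleC)
  then obtain C where C: "C \<ge> 0" "\<And>x. x \<in> V \<Longrightarrow> norm (U x) \<le> C * norm x" by auto
  have "U (T x) = x" if "x \<in> V" for x
    using unique blin_on_in[OF T that] that MV by simp
  then have "norm x \<le> C * norm (T x)" if "x \<in> V" for x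
    using C(2)[OF blin_on_in[OF T that]] that by simp
  then show ?thesis using C(1) by blast
qed

section \<open>Upper triangular operator matrices\<close>

lemma dscal_vector_space: "vector_space (dscal :: complex \<Rightarrow> (nat \<Rightarrow> 'h::complex_hilbert) \<Rightarrow> _)"
  by unfold_locales
    (auto simp: dscal_def fun_eq_iff scaleC.scale_right_distrib scaleC.scale_left_distrib)

lemma dnorm_tendsto_iff:
  fixes u :: "nat \<Rightarrow> nat \<Rightarrow> 'h::complex_hilbert"
  shows "(\<lambda>k. dnorm n (u k - x)) \<longlonglongrightarrow> 0 \<longleftrightarrow> (\<forall>i\<in>{1..n}. (\<lambda>k. u k i) \<longlonglongrightarrow> x i)"
proof
  assume *: "(\<lambda>k. dnorm n (u k - x)) \<longlonglongrightarrow> 0"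
  show "\<forall>i\<in>{1..n}. (\<lambda>k. u k i) \<longlonglongrightarrow> x i"
  proof
    fix i assume i: "i \<in> {1..n}"
    have "norm (u k i - x i) \<le> dnorm n (u k - x)" for k
    proof -
      have "(norm (u k i - x i))\<^sup>2 \<le> (\<Sum>i=1..n. (norm ((u k - x) i))\<^sup>2)"
        using member_le_sum[of i "{1..n}" "\<lambda>i. (norm ((u k - x) i))\<^sup>2"] i by simp
      then show ?thesis unfolding dnorm_def by (rule real_le_rsqrt)
    qed
    then have "(\<lambda>k. u k i - x i) \<longlonglongrightarrow> 0"
      by (rule Lim_null_comparison[OF always_eventually[OF allI] *])
    then show "(\<lambda>k. u k i) \<longlonglongrightarrow> x i" by (rule LIM_zero_cancel)
  qed
next
  assume *: "\<forall>i\<in>{1..n}. (\<lambda>k. u k i) \<longlonglongrightarrow> x i"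
  have "(\<lambda>k. dnorm n (u k - x)) \<longlonglongrightarrow> sqrt (\<Sum>i=1..n. (norm (x i - x i))\<^sup>2)"
    unfolding dnorm_def fun_diff_def
    by (intro tendsto_real_sqrt tendsto_sum tendsto_power tendsto_norm tendsto_diff tendsto_const)
      (use * in blast)
  then show "(\<lambda>k. dnorm n (u k - x)) \<longlonglongrightarrow> 0" by simp
qed

lemma dsum_lsubspace:
  assumes "\<And>k. k \<in> {1..n} \<Longrightarrow> csubspace (X k)"
  shows "lsubspace dscal (dsum X n) (dsum X n)"
  using assms unfolding lsubspace_def dsum_def dscal_def csubspace_iff scaleC.subspace_def
  by auto

text \<open>Induction in the order of back substitution: row \<open>i\<close> involves the unknown
  \<open>i\<close> and only later ones besides.\<close>

lemma downward_induct [consumes 1, case_names step]: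
  fixes i n :: nat
  assumes "i \<in> {1..n}"
    and "\<And>i. i \<in> {1..n} \<Longrightarrow> (\<And>j. j \<in> {i<..n} \<Longrightarrow> P j) \<Longrightarrow> P i"
  shows "P i"
  using assms(1)
proof (induction "n - i" arbitrary: i rule: less_induct)
  case less
  show ?case
  proof (rule assms(2)[OF less.prems])
    fix j assume "j \<in> {i<..n}"
    then show "P j" using less.prems by (intro less.hyps) auto
  qed
qed

text \<open>The matrix at one fixed value of lambda: \<open>E\<close> stands for lambda - D and
  \<open>B\<close> for -A, so lambda itself no longer occurs. The size is a parameter because the
  upper left corners of the matrix are needed as matrices of the same kind.\<close>

locale upper_triangular =
  fixes n :: nat
    and X :: "nat \<Rightarrow> 'h::complex_hilbert set"
    and E :: "nat \<Rightarrow> 'h \<Rightarrow> 'h"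
    and B :: "nat \<Rightarrow> nat \<Rightarrow> 'h \<Rightarrow> 'h"
  assumes X: "\<And>k. k \<in> {1..n} \<Longrightarrow> csubspace (X k)" "\<And>k. k \<in> {1..n} \<Longrightarrow> closed (X k)"
    and E: "\<And>k. k \<in> {1..n} \<Longrightarrow> blin_on (X k) (X k) (E k)"
    and B: "in_Bn n X B"
begin

abbreviation "V \<equiv> dsum X n"

abbreviation "T \<equiv> Tmat n E B"

lemma B_blin: "i \<in> {1..n} \<Longrightarrow> j \<in> {i<..n} \<Longrightarrow> blin_on (X j) (X i) (B i j)"
  using B by (auto simp: in_Bn_def)

lemma restrict: "m \<le> n \<Longrightarrow> upper_triangular m X E B"
  using X E B by unfold_locales (auto simp: in_Bn_def)

lemma coord_in: "x \<in> V \<Longrightarrow> i \<in> {1..n} \<Longrightarrow> x i \<in> X i"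
  by (simp add: dsum_def)

lemma V_eqI: "x \<in> V \<Longrightarrow> y \<in> V \<Longrightarrow> (\<And>i. i \<in> {1..n} \<Longrightarrow> x i = y i) \<Longrightarrow> x = y"
  by (rule ext) (metis (mono_tags, lifting) dsum_def mem_Collect_eq)

lemma sub_V: "lsubspace dscal V V"
  by (rule dsum_lsubspace) (rule X)

lemma V_diff: "x \<in> V \<Longrightarrow> y \<in> V \<Longrightarrow> x - y \<in> V"
  using X(1) csubspace_imp_subspace by (force simp: dsum_def intro: subspace_diff)

lemma T_coord: "i \<in> {1..n} \<Longrightarrow> T x i = E i (x i) + (\<Sum>j\<in>{i<..n}. B i j (x j))"
  by (simp add: Tmat_def)

lemma T_in: "x \<in> V \<Longrightarrow> T x \<in> V"
proof -
  assume x: "x \<in> V"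
  have "E i (x i) + (\<Sum>j\<in>{i<..n}. B i j (x j)) \<in> X i" if i: "i \<in> {1..n}" for i
  proof -
    have s: "subspace (X i)" using X i csubspace_imp_subspace by blast
    have "B i j (x j) \<in> X i" if "j \<in> {i<..n}" for j
      using blin_on_in[OF B_blin[OF i that]] coord_in[OF x, of j] i that by auto
    then have "(\<Sum>j\<in>{i<..n}. B i j (x j)) \<in> X i" by (rule subspace_sum[OF s])
    then show ?thesis
      using blin_on_in[OF E[OF i] coord_in[OF x i]] subspace_add[OF s] by blast
  qed
  then show "T x \<in> V" by (simp add: dsum_def Tmat_def)
qed

lemma T_add:
  assumes "x \<in> V" "y \<in> V"
  shows "T (x + y) = T x + T y"
proof
  fix i
  show "T (x + y) i = (T x + T y) i"
  proof (cases "i \<in> {1..n}")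
    case True
    have "B i j (x j + y j) = B i j (x j) + B i j (y j)" if "j \<in> {i<..n}" for j
      using True that assms by (intro blin_on_add[OF B_blin] coord_in) auto
    moreover have "E i (x i + y i) = E i (x i) + E i (y i)"
      using True assms by (intro blin_on_add[OF E] coord_in) auto
    ultimately show ?thesis
      using True by (simp add: T_coord sum.distrib algebra_simps)
  qed (auto simp: Tmat_def)
qed

lemma T_scale:
  assumes "x \<in> V"
  shows "T (dscal c x) = dscal c (T x)"
proof
  fix i
  show "T (dscal c x) i = dscal c (T x) i"
  proof (cases "i \<in> {1..n}")
    case True
    have "B i j (scaleC c (x j)) = scaleC c (B i j (x j))" if "j \<in> {i<..n}" for j
      using True that assms by (intro blin_on_scaleC[OF B_blin] coord_in) auto
    moreover have "E i (scaleC c (x i)) = scaleC c (E i (x i))"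
      using True assms by (intro blin_on_scaleC[OF E] coord_in) auto
    ultimately show ?thesis
      using True by (simp add: T_coord dscal_def scaleC.scale_right_distrib scaleC.scale_sum_right)
  qed (auto simp: Tmat_def dscal_def)
qed

lemma T_tendsto:
  assumes u: "\<And>k. u k \<in> V" and x: "x \<in> V"
    and lim: "\<And>i. i \<in> {1..n} \<Longrightarrow> (\<lambda>k. u k i) \<longlonglongrightarrow> x i" and i: "i \<in> {1..n}"
  shows "(\<lambda>k. T (u k) i) \<longlonglongrightarrow> T x i"
  unfolding T_coord[OF i]
proof (intro tendsto_add tendsto_sum)
  show "(\<lambda>k. E i (u k i)) \<longlonglongrightarrow> E i (x i)"
    by (rule blin_on_tendsto[OF E X(1)]) (use i u x lim coord_in in auto)
  fix j assume j: "j \<in> {i<..n}"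
  then have j': "j \<in> {1..n}" using i by auto
  show "(\<lambda>k. B i j (u k j)) \<longlonglongrightarrow> B i j (x j)"
    by (rule blin_on_tendsto[OF B_blin[OF i j] X(1)[OF j'] coord_in[OF u j'] coord_in[OF x j'] lim[OF j']])
qed

text \<open>The rows are solved from the last one upwards, each up to an error in
  \<open>M i\<close>. The sets \<open>M i\<close> are arbitrary because two choices occur:
  complements of the ranges of the diagonal entries, and the spans of finite sets that span modulo
  these ranges.\<close>

lemma back_substitution:
  assumes solve: "\<And>i v. i \<in> {1..n} \<Longrightarrow> v \<in> X i \<Longrightarrow> \<exists>u\<in>X i. v - E i u \<in> M i"
    and w: "w \<in> V"
  shows "\<exists>x\<in>V. \<forall>i\<in>{1..n}. w i - T x i \<in> M i"
proof -
  have "\<exists>x\<in>V. \<forall>i\<in>{n - k<..n}. w i - T x i \<in> M i" if "k \<le> n" for k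
    using that
  proof (induction k)
    case 0
    have "0 \<in> V" using sub_V by (simp add: lsubspace_def)
    then show ?case by auto
  next
    case (Suc k)
    then obtain x where x: "x \<in> V" "\<And>i. i \<in> {n - k<..n} \<Longrightarrow> w i - T x i \<in> M i" by auto
    define l where "l = n - k"
    have l: "l \<in> {1..n}" using Suc.prems by (auto simp: l_def)
    let ?r = "\<Sum>j\<in>{l<..n}. B l j (x j)"
    have s: "subspace (X l)" using X l csubspace_imp_subspace by blast
    have "B l j (x j) \<in> X l" if "j \<in> {l<..n}" for j
      using blin_on_in[OF B_blin[OF l that]] coord_in[OF x(1), of j] l that by auto
    then have "?r \<in> X l" by (rule subspace_sum[OF s])
    then have "w l - ?r \<in> X l" using coord_in[OF w l] subspace_diff[OF s] by blast
    then obtain v where v: "v \<in> X l" "w l - ?r - E l v \<in> M l" using solve[OF l] by blast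
    \<comment> \<open>Only coordinate \<open>l\<close> changes, and the rows after \<open>l\<close>
      do not involve it, so what they already satisfy is preserved.\<close>
    define y where "y = x(l := v)"
    have "y \<in> V" using x v l by (auto simp: dsum_def y_def)
    moreover have "w i - T y i \<in> M i" if i: "i \<in> {n - Suc k<..n}" for i
    proof (cases "i = l")
      case True
      have "(\<Sum>j\<in>{l<..n}. B l j (y j)) = ?r" by (rule sum.cong) (auto simp: y_def)
      then show ?thesis using v l True by (simp add: T_coord y_def algebra_simps)
    next
      case False
      then have i': "i \<in> {n - k<..n}" "i \<in> {1..n}" using i by (auto simp: l_def)
      have "(\<Sum>j\<in>{i<..n}. B i j (y j)) = (\<Sum>j\<in>{i<..n}. B i j (x j))"
        using i' by (intro sum.cong) (auto simp: y_def l_def)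
      then have "T y i = T x i" using i' False by (simp add: T_coord y_def)
      then show ?thesis using x(2)[OF i'(1)] by simp
    qed
    ultimately show ?case by blast
  qed
  moreover have "{n - n<..n} = {1..n}" by auto
  ultimately show ?thesis by (metis order_refl)
qed

section \<open>From the diagonal entries to the matrix\<close>

lemma left_inv_diagonal_imp_left_inv:
  assumes diag: "\<And>k. k \<in> {1..n} \<Longrightarrow> left_inv scaleC norm (X k) (E k)"
  shows "left_inv dscal (dnorm n) V T"
proof -
  have inj: "v = 0" if "k \<in> {1..n}" "v \<in> X k" "E k v = 0" for k v
    using diag[OF that(1)] that by (auto simp: left_inv_def alpha_eq_0_iff[OF scaleC.vector_space_axioms])
  have B0: "B i j 0 = 0" if "i \<in> {1..n}" "j \<in> {i<..n}" for i j
    using that by (intro blin_on_0[OF B_blin X(1)]) auto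
  have "\<forall>k\<in>{1..n}. \<exists>M. lsubspace scaleC (X k) M \<and> closed_sp norm (X k) M \<and> E k ` X k \<inter> M = {0}
      \<and> {r + m | r m. r \<in> E k ` X k \<and> m \<in> M} = X k"
    using diag by (auto simp: left_inv_def)
  then obtain M where Mk: "\<forall>k\<in>{1..n}. lsubspace scaleC (X k) (M k) \<and> closed_sp norm (X k) (M k)
      \<and> E k ` X k \<inter> M k = {0} \<and> {r + m | r m. r \<in> E k ` X k \<and> m \<in> M k} = X k"
    unfolding bchoice_iff by blast
  have M: "lsubspace scaleC (X k) (M k)" "closed_sp norm (X k) (M k)"
      "E k ` X k \<inter> M k = {0}" "{r + m | r m. r \<in> E k ` X k \<and> m \<in> M k} = X k" if "k \<in> {1..n}" for k
    by (insert bspec[OF Mk that], elim conjE, assumption)+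
  have MX: "M k \<subseteq> X k" "csubspace (M k)" if "k \<in> {1..n}" for k
    using M(1)[OF that] by (auto simp: lsubspace_def csubspace_def)
  have Mcl: "closed (M k)" if "k \<in> {1..n}" for k
    using M(2)[OF that] closed_sp_norm_iff[OF MX(1) X(2)] that by blast
  \<comment> \<open>More than injectivity: \<open>T x\<close> is only required to have its
    coordinates in the \<open>M i\<close>. This yields both the trivial kernel of \<open>T\<close>
    and the trivial intersection of its range with the direct sum of the \<open>M i\<close>.\<close>
  have zero: "x = 0" if x: "x \<in> V" and Tx: "\<And>i. i \<in> {1..n} \<Longrightarrow> T x i \<in> M i" for x
  proof (rule V_eqI[OF x])
    show "0 \<in> V" using sub_V by (simp add: lsubspace_def)
    fix i assume "i \<in> {1..n}"
    then have "x i = 0"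
    proof (induction rule: downward_induct)
      case (step i)
      have "(\<Sum>j\<in>{i<..n}. B i j (x j)) = 0"
        using step B0 by (intro sum.neutral) auto
      then have "E i (x i) \<in> M i" using Tx[OF step.hyps] step.hyps by (simp add: T_coord)
      then have "E i (x i) = 0" using M(3)[OF step.hyps] coord_in[OF x step.hyps] by blast
      then show ?case by (rule inj[OF step.hyps coord_in[OF x step.hyps]])
    qed
    then show "x i = 0 i" by simp
  qed
  have zeroM: "0 \<in> M k" if "k \<in> {1..n}" for k
    using M(1)[OF that] by (simp add: lsubspace_def)
  have MV: "dsum M n \<subseteq> V" using MX by (auto simp: dsum_def)
  have TV: "T ` V \<inter> dsum M n = {0}"
  proof -
    have "T x = 0" if "x \<in> V" "T x \<in> dsum M n" for x
    proof -
      have "x = 0" using zero[OF that(1)] that(2) by (simp add: dsum_def)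
      then show ?thesis using T_add[OF that(1) that(1)] by simp
    qed
    moreover have "0 \<in> T ` V"
    proof -
      have "0 \<in> V" using sub_V by (simp add: lsubspace_def)
      then have "T 0 = 0" using T_add[of 0 0] by simp
      then show ?thesis using \<open>0 \<in> V\<close> by (metis imageI)
    qed
    moreover have "0 \<in> dsum M n" using zeroM by (simp add: dsum_def)
    ultimately show ?thesis by auto
  qed
  have "alpha dscal V T = 0"
    unfolding alpha_eq_0_iff[OF dscal_vector_space] using zero zeroM by (metis zero_fun_apply)
  moreover have "closed_sp (dnorm n) V (T ` V)"
    unfolding closed_sp_def
  proof (intro allI impI)
    fix u w assume u: "\<forall>k. u k \<in> T ` V" and w: "w \<in> V" and "(\<lambda>k. dnorm n (u k - w)) \<longlonglongrightarrow> 0"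
    then have lim: "(\<lambda>k. u k i) \<longlonglongrightarrow> w i" if "i \<in> {1..n}" for i
      using that by (simp add: dnorm_tendsto_iff)
    have "\<forall>k. \<exists>x. x \<in> V \<and> u k = T x" using u by blast
    then obtain x where x: "\<And>k. x k \<in> V" "\<And>k. u k = T (x k)" by metis
    \<comment> \<open>Convergence of the preimages passes upwards through the rows: once the later
      coordinates converge, so does \<open>E i (x k i)\<close>, and \<open>E i\<close> is bounded
      below.\<close>
    have "\<exists>y\<in>X i. (\<lambda>k. x k i) \<longlonglongrightarrow> y" if "i \<in> {1..n}" for i
      using that
    proof (induction rule: downward_induct)
      case (step i)
      then obtain y where y: "\<And>j. j \<in> {i<..n} \<Longrightarrow> y j \<in> X j"
        "\<And>j. j \<in> {i<..n} \<Longrightarrow> (\<lambda>k. x k j) \<longlonglongrightarrow> y j" by metis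
      have "(\<lambda>k. \<Sum>j\<in>{i<..n}. B i j (x k j)) \<longlonglongrightarrow> (\<Sum>j\<in>{i<..n}. B i j (y j))"
      proof (rule tendsto_sum)
        fix j assume j: "j \<in> {i<..n}"
        then have j': "j \<in> {1..n}" using step.hyps by auto
        show "(\<lambda>k. B i j (x k j)) \<longlonglongrightarrow> B i j (y j)"
          by (rule blin_on_tendsto[OF B_blin[OF step.hyps j] X(1)[OF j'] coord_in[OF x(1) j'] y(1)[OF j] y(2)[OF j]])
      qed
      then have "(\<lambda>k. u k i - (\<Sum>j\<in>{i<..n}. B i j (x k j))) \<longlonglongrightarrow> w i - (\<Sum>j\<in>{i<..n}. B i j (y j))"
        by (rule tendsto_diff[OF lim[OF step.hyps]])
      then have Elim: "(\<lambda>k. E i (x k i)) \<longlonglongrightarrow> w i - (\<Sum>j\<in>{i<..n}. B i j (y j))"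
        by (simp add: x(2) T_coord[OF step.hyps])
      obtain C where C: "\<And>v. v \<in> X i \<Longrightarrow> norm v \<le> C * norm (E i v)"
        using left_inv_bounded_below[OF X(1,2) E diag] step.hyps by metis
      show ?case
        by (rule bounded_below_convergent[OF E X(1,2) C coord_in[OF x(1)] Elim]) (use step.hyps in auto)
    qed
    then obtain y where y: "\<And>i. i \<in> {1..n} \<Longrightarrow> y i \<in> X i" "\<And>i. i \<in> {1..n} \<Longrightarrow> (\<lambda>k. x k i) \<longlonglongrightarrow> y i"
      by metis
    \<comment> \<open>The limits are known only for indices in \<open>{1..n}\<close>; an element of
      the direct sum must vanish elsewhere.\<close>
    define z where "z i = (if i \<in> {1..n} then y i else 0)" for i
    have zV: "z \<in> V" using y(1) by (simp add: dsum_def z_def)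
    have "T z i = w i" if i: "i \<in> {1..n}" for i
    proof (rule LIMSEQ_unique)
      show "(\<lambda>k. u k i) \<longlonglongrightarrow> w i" by (rule lim[OF i])
      show "(\<lambda>k. u k i) \<longlonglongrightarrow> T z i"
        unfolding x(2) using y(2) by (intro T_tendsto x(1) zV i) (simp add: z_def)
    qed
    then have "T z = w" by (rule V_eqI[OF T_in[OF zV] w])
    then show "w \<in> T ` V" using zV by blast
  qed
  moreover have "lsubspace dscal V (dsum M n)"
    using dsum_lsubspace[of n M] MX(2) MV by (auto simp: lsubspace_def)
  moreover have "closed_sp (dnorm n) V (dsum M n)"
    unfolding closed_sp_def dnorm_tendsto_iff
  proof (intro allI impI)
    fix u x assume u: "\<forall>k. u k \<in> dsum M n" and x: "x \<in> V"
      and lim: "\<forall>i\<in>{1..n}. (\<lambda>k. u k i) \<longlonglongrightarrow> x i"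
    have "x i \<in> M i" if i: "i \<in> {1..n}" for i
    proof (rule closed_sequentially[OF Mcl[OF i]])
      show "u k i \<in> M i" for k using u i by (simp add: dsum_def)
      show "(\<lambda>k. u k i) \<longlonglongrightarrow> x i" using lim i by blast
    qed
    then show "x \<in> dsum M n" using x by (simp add: dsum_def)
  qed
  moreover have "{r + m | r m. r \<in> T ` V \<and> m \<in> dsum M n} = V"
  proof (intro equalityI subsetI)
    fix w assume "w \<in> {r + m | r m. r \<in> T ` V \<and> m \<in> dsum M n}"
    then obtain x m where "x \<in> V" "m \<in> V" "w = T x + m" using MV by blast
    then show "w \<in> V" using T_in sub_V by (simp add: lsubspace_def)
  next
    fix w assume w: "w \<in> V"
    have "\<exists>u\<in>X i. v - E i u \<in> M i" if "i \<in> {1..n}" "v \<in> X i" for i v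
    proof -
      have "v \<in> {r + m | r m. r \<in> E i ` X i \<and> m \<in> M i}" using M(4) that by simp
      then obtain u m where "u \<in> X i" "m \<in> M i" "v = E i u + m" by blast
      then show ?thesis by (intro bexI[of _ u]) auto
    qed
    then obtain x where x: "x \<in> V" "\<forall>i\<in>{1..n}. w i - T x i \<in> M i"
      using back_substitution[OF _ w] by blast
    then have "w - T x \<in> dsum M n" using w T_in[OF x(1)] by (simp add: dsum_def)
    moreover have "w = T x + (w - T x)" by simp
    ultimately show "w \<in> {r + m | r m. r \<in> T ` V \<and> m \<in> dsum M n}" using x(1) by blast
  qed
  ultimately show ?thesis using TV unfolding left_inv_def by blast
qed

section \<open>From the matrix to its diagonal entries\<close>

lemma left_inv_imp_left_inv_first:
  assumes n: "1 \<le> n" and left_inv: "left_inv dscal (dnorm n) V T"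
  shows "left_inv scaleC norm (X 1) (E 1)"
proof -
  note One_nat_def [simp del]
  have 1: "1 \<in> {1..n}" using n by simp
  define e :: "'h \<Rightarrow> nat \<Rightarrow> 'h" where "e v = (\<lambda>i. if i = 1 then v else 0)" for v
  have s1: "subspace (X 1)" using csubspace_imp_subspace X(1)[OF 1] by blast
  have zeroX: "0 \<in> X i" if "i \<in> {1..n}" for i
    using X(1)[OF that] by (simp add: csubspace_iff scaleC.subspace_0)
  have eV: "e v \<in> V" if "v \<in> X 1" for v using that zeroX n by (auto simp: dsum_def e_def)
  have e_add: "e (v + v') = e v + e v'" for v v' by (auto simp: e_def)
  have e_scale: "e (scaleC c v) = dscal c (e v)" for c v by (auto simp: e_def dscal_def)
  have Te: "T (e v) = e (E 1 v)" if v: "v \<in> X 1" for v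
  proof (rule V_eqI)
    show "T (e v) \<in> V" by (rule T_in[OF eV[OF v]])
    show "e (E 1 v) \<in> V" by (rule eV[OF blin_on_in[OF E[OF 1] v]])
    fix i assume i: "i \<in> {1..n}"
    have "B i j (e v j) = 0" if j: "j \<in> {i<..n}" for j
    proof -
      have "j \<in> {1..n}" "e v j = 0" using i j by (auto simp: e_def)
      then show ?thesis using blin_on_0[OF B_blin[OF i j] X(1)] by simp
    qed
    then have "T (e v) i = E i (e v i)" using i by (simp add: T_coord)
    then show "T (e v) i = e (E 1 v) i" using blin_on_0[OF E X(1), OF i i] by (simp add: e_def)
  qed
  have T': "\<forall>x\<in>V. T x \<in> V" "\<forall>x\<in>V. \<forall>y\<in>V. T (x + y) = T x + T y"
    "\<forall>c. \<forall>x\<in>V. T (dscal c x) = dscal c (T x)"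
    by (auto simp: T_in T_add T_scale)
  obtain M U where M: "lsubspace dscal V M" "closed_sp (dnorm n) V M"
    and U: "\<forall>x\<in>V. U x \<in> V \<and> x - T (U x) \<in> M"
    and unique: "\<forall>x\<in>V. \<forall>u\<in>V. x - T u \<in> M \<longrightarrow> U x = u"
    and U_add: "\<forall>x\<in>V. \<forall>y\<in>V. U (x + y) = U x + U y"
    and U_scale: "\<forall>c. \<forall>x\<in>V. U (dscal c x) = dscal c (U x)"
    using left_inv_solution[where T = T, OF dscal_vector_space sub_V T'(1,2,3) left_inv]
    by (elim exE conjE) (rule that)
  have zeroM: "0 \<in> M" using M(1) by (simp add: lsubspace_def)
  define Y where "Y v = U (e v)" for v
  have YV: "Y v \<in> V" "e v - T (Y v) \<in> M" if "v \<in> X 1" for v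
    using U eV[OF that] by (auto simp: Y_def)
  have Y_add: "Y (v + v') = Y v + Y v'" if "v \<in> X 1" "v' \<in> X 1" for v v'
    using U_add eV[OF that(1)] eV[OF that(2)] by (simp add: Y_def e_add)
  have Y_scale: "Y (scaleC c v) = dscal c (Y v)" if "v \<in> X 1" for c v
    using U_scale eV[OF that] by (simp add: Y_def e_scale)
  have Y_unique: "Y v = y" if "v \<in> X 1" "y \<in> V" "e v - T y \<in> M" for v y
    using unique eV[OF that(1)] that by (simp add: Y_def)
  \<comment> \<open>The residual \<open>e (E 1 v) - T (e v)\<close> is 0 and lies in
    \<open>M\<close>, so uniqueness forces the solution \<open>e v\<close>. Reading off coordinate 1
    shows that \<open>Y\<close> followed by this coordinate is a left inverse of
    \<open>E 1\<close>.\<close>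
  have YE: "Y (E 1 v) = e v" if v: "v \<in> X 1" for v
    using Y_unique[OF blin_on_in[OF E[OF 1] v] eV[OF v]] zeroM by (simp add: Te[OF v])
  have graph: "\<forall>i\<in>{1..n}. Y v i = y i"
    if u: "\<And>k. u k \<in> X 1" and v: "v \<in> X 1" "u \<longlonglongrightarrow> v"
      and lim: "\<And>i. i \<in> {1..n} \<Longrightarrow> (\<lambda>k. Y (u k) i) \<longlonglongrightarrow> y i" for u v y
  proof -
    define z where "z i = (if i \<in> {1..n} then y i else 0)" for i
    have limz: "(\<lambda>k. Y (u k) i) \<longlonglongrightarrow> z i" if "i \<in> {1..n}" for i
      using lim[OF that] that by (simp add: z_def)
    have "z i \<in> X i" if i: "i \<in> {1..n}" for i
      by (rule closed_sequentially[OF X(2)[OF i] coord_in[OF YV(1)[OF u] i] limz[OF i]])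
    then have zV: "z \<in> V" by (simp add: dsum_def z_def)
    have "(\<lambda>k. e (u k) i) \<longlonglongrightarrow> e v i" for i
      using v(2) by (cases "i = 1") (auto simp: e_def)
    then have "(\<lambda>k. (e (u k) - T (Y (u k))) i) \<longlonglongrightarrow> (e v - T z) i" if "i \<in> {1..n}" for i
      using T_tendsto[OF YV(1)[OF u] zV limz that] by (simp add: tendsto_diff)
    then have "(\<lambda>k. dnorm n ((e (u k) - T (Y (u k))) - (e v - T z))) \<longlonglongrightarrow> 0"
      using dnorm_tendsto_iff[of n "\<lambda>k. e (u k) - T (Y (u k))" "e v - T z"] by blast
    moreover have "e v - T z \<in> V"
      by (rule V_diff[OF eV[OF v(1)] T_in[OF zV]])
    ultimately have "e v - T z \<in> M"
      using M(2)[unfolded closed_sp_def, rule_format, of "\<lambda>k. e (u k) - T (Y (u k))" "e v - T z"]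
        YV(2)[OF u] by blast
    then have "Y v = z" by (rule Y_unique[OF v(1) zV])
    then show ?thesis by (simp add: z_def)
  qed
  have "\<exists>C\<ge>0. \<forall>v\<in>X 1. \<forall>i\<in>{1..n}. norm (Y v i) \<le> C * norm v"
  proof (rule closed_graph_coordinatewise[OF s1 X(2)[OF 1]])
    show "Y (x + y) i = Y x i + Y y i" if "x \<in> X 1" "y \<in> X 1" for x y i
      using Y_add[OF that] by simp
    show "Y (r *\<^sub>R x) i = r *\<^sub>R Y x i" if "x \<in> X 1" for r x i
      using Y_scale[OF that, of "complex_of_real r"] by (simp add: scaleR_scaleC dscal_def)
    show "\<forall>i\<in>{1..n}. Y x i = y i" if "\<And>k. u k \<in> X 1" "x \<in> X 1" "u \<longlonglongrightarrow> x"
      "\<And>i. i \<in> {1..n} \<Longrightarrow> (\<lambda>k. Y (u k) i) \<longlonglongrightarrow> y i" for u x y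
      by (rule graph[OF that])
  qed simp
  then obtain C where C: "\<And>v i. v \<in> X 1 \<Longrightarrow> i \<in> {1..n} \<Longrightarrow> norm (Y v i) \<le> C * norm v" by blast
  have bb: "norm v \<le> C * norm (E 1 v)" if v: "v \<in> X 1" for v
    using C[OF blin_on_in[OF E[OF 1] v] 1] by (simp add: YE[OF v] e_def)
  \<comment> \<open>The kernel of the left inverse \<open>\<lambda>v. Y v 1\<close> of
    \<open>E 1\<close>. The vector \<open>v - E 1 (Y v 1)\<close> always lies in it, which gives the
    decomposition of \<open>X 1\<close>.\<close>
  define N where "N = {v \<in> X 1. Y v 1 = 0}"
  have N_sub: "lsubspace scaleC (X 1) N"
  proof -
    have "scaleC.subspace (X 1)" using X(1)[OF 1] by (simp add: csubspace_iff)
    moreover have "Y 0 = 0" using Y_scale[OF zeroX[OF 1], of 0] by (simp add: dscal_def fun_eq_iff)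
    ultimately have "scaleC.subspace N"
      unfolding N_def scaleC.subspace_def by (simp add: Y_add Y_scale dscal_def del: One_nat_def)
    then show ?thesis by (auto simp: lsubspace_def scaleC.subspace_def N_def)
  qed
  show ?thesis
    unfolding left_inv_def
  proof (intro conjI exI[of _ N])
    show "alpha scaleC (X 1) (E 1) = 0"
      unfolding alpha_eq_0_iff[OF scaleC.vector_space_axioms] using bb by fastforce
    have "closed (E 1 ` X 1)"
      unfolding closed_sequential_limits
    proof (intro allI impI, elim conjE)
      fix u w assume u: "\<forall>k. u k \<in> E 1 ` X 1" and lim: "u \<longlonglongrightarrow> w"
      have "\<forall>k. \<exists>v. v \<in> X 1 \<and> u k = E 1 v" using u by blast
      then obtain v where v: "\<And>k. v k \<in> X 1" "\<And>k. u k = E 1 (v k)" by metis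
      have lim': "(\<lambda>k. E 1 (v k)) \<longlonglongrightarrow> w" using lim by (simp add: v(2)[symmetric])
      obtain x where x: "x \<in> X 1" "v \<longlonglongrightarrow> x"
        using bounded_below_convergent[where u = v, OF E[OF 1] X(1)[OF 1] X(2)[OF 1] bb v(1) lim']
        by blast
      have "(\<lambda>k. E 1 (v k)) \<longlonglongrightarrow> E 1 x" by (rule blin_on_tendsto[OF E[OF 1] X(1)[OF 1] v(1) x])
      then have "w = E 1 x" using lim' LIMSEQ_unique by blast
      then show "w \<in> E 1 ` X 1" using x(1) by blast
    qed
    then show "closed_sp norm (X 1) (E 1 ` X 1)"
      using closed_sp_norm_iff[OF _ X(2)[OF 1]] E[OF 1] by (simp add: blin_on_def)
    show "lsubspace scaleC (X 1) N" by (rule N_sub)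
    have "closed N"
      unfolding closed_sequential_limits
    proof (intro allI impI, elim conjE)
      fix u w assume "\<forall>k. u k \<in> N" and lim: "u \<longlonglongrightarrow> w"
      then have u: "u k \<in> X 1" "Y (u k) 1 = 0" for k by (auto simp: N_def)
      have w: "w \<in> X 1" by (rule closed_sequentially[OF X(2)[OF 1] u(1) lim])
      have "norm (Y w 1) \<le> C * norm (w - u k)" for k
      proof -
        have "Y w 1 = Y (w - u k) 1"
          using Y_add[OF subspace_diff[OF s1 w u(1)[of k]] u(1)[of k]] u(2)[of k] by simp
        then show ?thesis using C[OF subspace_diff[OF s1 w u(1)[of k]] 1] by simp
      qed
      moreover have "(\<lambda>k. C * norm (w - u k)) \<longlonglongrightarrow> C * norm (w - w)"
        by (intro tendsto_intros lim)
      ultimately have "norm (Y w 1) \<le> C * norm (w - w)"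
        by (intro LIMSEQ_le_const[of "\<lambda>k. C * norm (w - u k)"]) auto
      then show "w \<in> N" using w by (simp add: N_def)
    qed
    then show "closed_sp norm (X 1) N"
      using closed_sp_norm_iff[OF _ X(2)[OF 1]] by (simp add: N_def)
    show "E 1 ` X 1 \<inter> N = {0}"
    proof -
      have "E 1 v = 0" if "v \<in> X 1" "E 1 v \<in> N" for v
        using that YE[OF that(1)] blin_on_0[OF E[OF 1] X(1)[OF 1]] by (simp add: N_def e_def)
      moreover have "0 \<in> E 1 ` X 1"
        using blin_on_0[OF E[OF 1] X(1)[OF 1]] zeroX[OF 1] by (metis imageI)
      moreover have "0 \<in> N" using N_sub by (simp add: lsubspace_def)
      ultimately show ?thesis by auto
    qed
    show "{r + m | r m. r \<in> E 1 ` X 1 \<and> m \<in> N} = X 1"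
    proof (intro equalityI subsetI)
      fix w assume "w \<in> {r + m | r m. r \<in> E 1 ` X 1 \<and> m \<in> N}"
      then obtain v m where "v \<in> X 1" "m \<in> X 1" "w = E 1 v + m" by (auto simp: N_def)
      then show "w \<in> X 1" using subspace_add[OF s1 blin_on_in[OF E[OF 1]]] by blast
    next
      fix w assume w: "w \<in> X 1"
      let ?v = "Y w 1"
      have v: "?v \<in> X 1" by (rule coord_in[OF YV(1)[OF w] 1])
      have Ev: "E 1 ?v \<in> X 1" by (rule blin_on_in[OF E[OF 1] v])
      have d: "w - E 1 ?v \<in> X 1" by (rule subspace_diff[OF s1 w Ev])
      have "Y w 1 = Y (w - E 1 ?v) 1 + Y (E 1 ?v) 1" using fun_cong[OF Y_add[OF d Ev], of 1] by simp
      then have "Y (w - E 1 ?v) 1 = 0" using YE[OF v] by (simp add: e_def)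
      then have "w - E 1 ?v \<in> N" using d by (simp add: N_def)
      moreover have "w = E 1 ?v + (w - E 1 ?v)" by simp
      ultimately show "w \<in> {r + m | r m. r \<in> E 1 ` X 1 \<and> m \<in> N}" using v by blast
    qed
  qed
qed

text \<open>Suppose more independent kernel vectors of \<open>E k\<close> than the finite sets
  \<open>G s\<close> have elements in total. The entries of column \<open>k\<close> above the
  diagonal, applied to these vectors, can be solved in the upper left corner up to combinations of
  the \<open>G s\<close>. Some nontrivial combination has all these residual coefficients zero, and
  then its column is cancelled exactly by the corner, which produces a nonzero kernel vector of
  \<open>T\<close>. As alpha is a supremum over finite independent families, bounding the size of
  each such family bounds alpha.\<close>

lemma alpha_le_sum_beta:
  assumes inj: "\<And>x. x \<in> V \<Longrightarrow> T x = 0 \<Longrightarrow> x = 0" and k: "k \<in> {1..n}"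
  shows "alpha scaleC (X k) (E k) \<le> (\<Sum>s\<in>{1..k-1}. beta scaleC (X s) (E s))"
proof (cases "\<exists>s\<in>{1..k-1}. beta scaleC (X s) (E s) = \<infinity>")
  case True
  then obtain s where "s \<in> {1..k-1}" "beta scaleC (X s) (E s) = \<infinity>" by blast
  then have "\<infinity> \<le> (\<Sum>s\<in>{1..k-1}. beta scaleC (X s) (E s))"
    using member_le_sum[of s "{1..k-1}" "\<lambda>s. beta scaleC (X s) (E s)"] by simp
  then show ?thesis by simp
next
  case False
  \<comment> \<open>The corner strictly above and to the left of entry \<open>k\<close>. For
    \<open>k = 1\<close> it is empty, the sum of the beta is 0, and the bound says that
    \<open>E 1\<close> is injective.\<close>
  interpret R: upper_triangular "k - 1" X E B by (rule restrict) (use k in auto)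
  have lt: "s \<in> {1..n}" "k \<in> {s<..n}" if "s \<in> {1..k-1}" for s using that k by auto
  have "\<forall>s\<in>{1..k-1}. \<exists>G. finite G \<and> G \<subseteq> X s \<and> enat (card G) \<le> beta scaleC (X s) (E s) \<and>
      (\<forall>v\<in>X s. \<exists>r\<in>E s ` X s. \<exists>c. v - r = (\<Sum>g\<in>G. scaleC (c g) g))"
    unfolding beta_def using False
    by (intro ballI codim_finite_imp_spanning blin_on_csubspace_range[OF R.X(1) R.E] R.X(1))
      (auto simp: beta_def)
  then obtain G where G: "\<forall>s\<in>{1..k-1}. finite (G s) \<and> G s \<subseteq> X s \<and>
      enat (card (G s)) \<le> beta scaleC (X s) (E s) \<and>
      (\<forall>v\<in>X s. \<exists>r\<in>E s ` X s. \<exists>c. v - r = (\<Sum>g\<in>G s. scaleC (c g) g))"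
    unfolding bchoice_iff by blast
  \<comment> \<open>One scalar equation for each pair \<open>(s, g)\<close>. Pairs are counted
    because the sets \<open>G s\<close> lie in one common type and may overlap.\<close>
  define J where "J = (SIGMA s:{1..k-1}. G s)"
  have "\<forall>s\<in>{1..k-1}. finite (G s)" using G by blast
  then have J: "finite J" "card J = (\<Sum>s\<in>{1..k-1}. card (G s))"
    unfolding J_def by (auto intro!: card_SigmaI)
  have card_F: "card F \<le> card J"
    if F: "finite F" "F \<subseteq> {v \<in> X k. E k v = 0}" "indep_mod scaleC {0} F" for F
  proof (rule ccontr)
    assume "\<not> ?thesis"
    then have less: "card J < card F" by simp
    \<comment> \<open>Column \<open>k\<close> above the diagonal, applied to \<open>v\<close>, as a
      vector in the space of the corner.\<close>
    define w where "w v = (\<lambda>i. if i \<in> {1..k-1} then B i k v else 0)" for v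
    have Fk: "v \<in> X k" "E k v = 0" if "v \<in> F" for v using F(2) that by auto
    have "\<forall>v\<in>F. \<exists>y c. y \<in> R.V \<and>
        (\<forall>i\<in>{1..k-1}. w v i - R.T y i = (\<Sum>g\<in>G i. scaleC (c (i, g)) g))"
    proof
      fix v assume v: "v \<in> F"
      have wV: "w v \<in> R.V"
        using blin_on_in[OF B_blin[OF lt] Fk(1)[OF v]] by (simp add: dsum_def w_def)
      have "\<exists>u\<in>X i. v - E i u \<in> {x. \<exists>c. x = (\<Sum>g\<in>G i. scaleC (c g) g)}"
        if "i \<in> {1..k-1}" "v \<in> X i" for i v
        using G that by blast
      from R.back_substitution[OF this wV] obtain y where y: "y \<in> R.V"
        "\<forall>i\<in>{1..k-1}. \<exists>c. w v i - R.T y i = (\<Sum>g\<in>G i. scaleC (c g) g)"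
        by blast
      then obtain c where "\<forall>i\<in>{1..k-1}. w v i - R.T y i = (\<Sum>g\<in>G i. scaleC (c i g) g)"
        unfolding bchoice_iff by blast
      then show "\<exists>y c. y \<in> R.V \<and>
          (\<forall>i\<in>{1..k-1}. w v i - R.T y i = (\<Sum>g\<in>G i. scaleC (c (i, g)) g))"
        using y(1) by (intro exI[of _ y] exI[of _ "\<lambda>(i, g). c i g"]) simp
    qed
    from bchoice[OF this] obtain y where "\<forall>v\<in>F. \<exists>c. y v \<in> R.V \<and>
        (\<forall>i\<in>{1..k-1}. w v i - R.T (y v) i = (\<Sum>g\<in>G i. scaleC (c (i, g)) g))" by blast
    from bchoice[OF this] obtain c where "\<forall>v\<in>F. y v \<in> R.V \<and>
        (\<forall>i\<in>{1..k-1}. w v i - R.T (y v) i = (\<Sum>g\<in>G i. scaleC (c v (i, g)) g))" by blast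
    then have y: "\<And>v. v \<in> F \<Longrightarrow> y v \<in> R.V"
      and yc: "\<And>v i. v \<in> F \<Longrightarrow> i \<in> {1..k-1} \<Longrightarrow>
        w v i - R.T (y v) i = (\<Sum>g\<in>G i. scaleC (c v (i, g)) g)"
      by auto
    obtain a where a: "\<exists>v\<in>F. a v \<noteq> 0" "\<forall>p\<in>J. (\<Sum>v\<in>F. a v * c v p) = 0"
      using underdetermined_system[OF J(1) F(1) less] by blast
    \<comment> \<open>a vector of the kernel of \<open>T\<close> whose \<open>k\<close>-th coordinate is a nontrivial combination of \<open>F\<close>\<close>
    define b where "b v = - a v" for v
    define x where "x = (\<lambda>i. if i \<in> {1..k-1} then \<Sum>v\<in>F. scaleC (b v) (y v i)
        else if i = k then \<Sum>v\<in>F. scaleC (a v) v else 0)"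
    have xk: "x k = (\<Sum>v\<in>F. scaleC (a v) v)" using k by (auto simp: x_def)
    have yX: "y v i \<in> X i" if "v \<in> F" "i \<in> {1..k-1}" for v i
      using R.coord_in[OF y] that by blast
    have comb: "(\<Sum>v\<in>F. scaleC (b v) (z v)) \<in> X i"
      if "i \<in> {1..n}" "\<And>v. v \<in> F \<Longrightarrow> z v \<in> X i" for b z i
      using X(1)[OF that(1)] that(2) unfolding csubspace_iff
      by (intro scaleC.subspace_sum scaleC.subspace_scale)
    have xV: "x \<in> V"
      unfolding dsum_def
    proof (intro CollectI allI conjI impI)
      fix i assume i: "i \<in> {1..n}"
      have "0 \<in> X i" using X(1)[OF i] by (simp add: csubspace_iff scaleC.subspace_0)
      then show "x i \<in> X i" using comb[OF i] yX Fk(1) by (auto simp: x_def)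
    qed (use k in \<open>auto simp: x_def\<close>)
    have "T x i = 0" if i: "i \<in> {1..n}" for i
    proof -
      consider "i \<in> {1..k-1}" | "i = k" | "k < i" using i by fastforce
      then show ?thesis
      proof cases
        case 1
        have B0: "B i j (x j) = 0" if "j \<in> {k<..n}" for j
        proof -
          have "x j = 0" "j \<in> {i<..n}" "j \<in> {1..n}" using that 1 by (auto simp: x_def)
          then show ?thesis using blin_on_0[OF B_blin[OF i] X(1)] by simp
        qed
        have Bj: "B i j (x j) = (\<Sum>v\<in>F. scaleC (b v) (B i j (y v j)))" if "j \<in> {i<..k-1}" for j
        proof -
          have j: "j \<in> {i<..n}" "j \<in> {1..n}" "j \<in> {1..k-1}" using that 1 k by auto
          have "B i j (\<Sum>v\<in>F. scaleC (b v) (y v j)) = (\<Sum>v\<in>F. scaleC (b v) (B i j (y v j)))"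
            using j yX by (intro blin_on_sum[OF B_blin[OF i] X(1)]) auto
          then show ?thesis using j by (simp add: x_def)
        qed
        have Bk: "B i k (x k) = (\<Sum>v\<in>F. scaleC (a v) (B i k v))"
        proof -
          have "B i k (\<Sum>v\<in>F. scaleC (a v) v) = (\<Sum>v\<in>F. scaleC (a v) (B i k v))"
            using lt(2)[OF 1] k Fk by (intro blin_on_sum[OF B_blin[OF i] X(1)]) auto
          then show ?thesis by (simp only: xk)
        qed
        have Ei: "E i (x i) = (\<Sum>v\<in>F. scaleC (b v) (E i (y v i)))"
        proof -
          have "E i (\<Sum>v\<in>F. scaleC (b v) (y v i)) = (\<Sum>v\<in>F. scaleC (b v) (E i (y v i)))"
            using 1 yX i by (intro blin_on_sum[OF E X(1)]) auto
          then show ?thesis using 1 by (simp add: x_def)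
        qed
        \<comment> \<open>\<open>x\<close> vanishes beyond \<open>k\<close>. Column \<open>k\<close>
          is split off since it contributes the vectors \<open>w v\<close>, while the columns before
          it belong to row \<open>i\<close> of the corner.\<close>
        have "(\<Sum>j\<in>{i<..n}. B i j (x j)) = (\<Sum>j\<in>{i<..k}. B i j (x j))"
          by (rule sum.mono_neutral_right) (use B0 k in auto)
        also have "{i<..k} = insert k {i<..k-1}" using 1 by auto
        also have "(\<Sum>j\<in>insert k {i<..k-1}. B i j (x j)) = (\<Sum>j\<in>{i<..k-1}. B i j (x j)) + B i k (x k)"
          using k by (subst sum.insert) (auto simp: add.commute)
        also have "(\<Sum>j\<in>{i<..k-1}. B i j (x j)) =
            (\<Sum>v\<in>F. scaleC (b v) (\<Sum>j\<in>{i<..k-1}. B i j (y v j)))"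
          by (simp add: Bj scaleC.scale_sum_right) (rule sum.swap)
        finally have "T x i = (\<Sum>v\<in>F. scaleC (b v) (R.T (y v) i) + scaleC (a v) (w v i))"
          using 1 by (simp only: T_coord[OF i] R.T_coord[OF 1] Ei Bk w_def if_True
              scaleC.scale_right_distrib sum.distrib add.assoc)
        also have "\<dots> = (\<Sum>v\<in>F. scaleC (a v) (w v i - R.T (y v) i))"
          by (rule sum.cong) (simp_all add: b_def scaleC.scale_right_diff_distrib)
        also have "\<dots> = (\<Sum>v\<in>F. \<Sum>g\<in>G i. scaleC (a v * c v (i, g)) g)"
          using yc 1 by (simp add: scaleC.scale_sum_right)
        also have "\<dots> = (\<Sum>g\<in>G i. scaleC (\<Sum>v\<in>F. a v * c v (i, g)) g)"
          by (subst sum.swap) (simp add: scaleC.scale_sum_left)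
        also have "\<dots> = 0"
          using a(2) 1 by (intro sum.neutral) (auto simp: J_def)
        finally show ?thesis .
      next
        case 2
        have "B k j (x j) = 0" if j: "j \<in> {k<..n}" for j
        proof -
          have "x j = 0" "j \<in> {1..n}" using j by (auto simp: x_def)
          then show ?thesis using blin_on_0[OF B_blin[OF k j] X(1)] by simp
        qed
        moreover have "E k (x k) = 0"
        proof -
          have "E k (\<Sum>v\<in>F. scaleC (a v) v) = (\<Sum>v\<in>F. scaleC (a v) (E k v))"
            using Fk k by (intro blin_on_sum[OF E X(1)]) auto
          then show ?thesis using Fk(2) by (simp add: xk)
        qed
        ultimately show ?thesis using 2 k by (simp add: T_coord)
      next
        case 3
        have "x j = 0" if "j \<ge> i" for j using that 3 by (auto simp: x_def)
        moreover have "B i j 0 = 0" if j: "j \<in> {i<..n}" for j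
        proof -
          have "j \<in> {1..n}" using i j by auto
          then show ?thesis using blin_on_0[OF B_blin[OF i j] X(1)] by simp
        qed
        ultimately show ?thesis using blin_on_0[OF E[OF i] X(1)[OF i]] i by (simp add: T_coord)
      qed
    qed
    then have "T x = 0"
      using sub_V by (intro V_eqI[OF T_in[OF xV]]) (auto simp: lsubspace_def)
    then have "x = 0" by (rule inj[OF xV])
    then have "x k = 0" by simp
    then have "(\<Sum>v\<in>F. scaleC (a v) v) \<in> {0}" by (simp add: xk)
    then have "\<forall>v\<in>F. a v = 0" using F(3) by (simp add: indep_mod_def)
    then show False using a(1) by blast
  qed
  have "enat (card J) = (\<Sum>s\<in>{1..k-1}. enat (card (G s)))"
    unfolding J(2) by (simp add: of_nat_eq_enat[symmetric] del: of_nat_eq_enat)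
  also have "\<dots> \<le> (\<Sum>s\<in>{1..k-1}. beta scaleC (X s) (E s))"
    using G by (intro sum_mono) blast
  finally have "enat (card J) \<le> (\<Sum>s\<in>{1..k-1}. beta scaleC (X s) (E s))" .
  moreover have "alpha scaleC (X k) (E k) \<le> enat (card J)"
    unfolding alpha_def ldim_def codim_def
  proof (rule Sup_least)
    fix b assume "b \<in> {enat (card F) | F. finite F \<and> F \<subseteq> {x \<in> X k. E k x = 0} \<and> indep_mod scaleC {0} F}"
    then obtain F where "b = enat (card F)" "finite F" "F \<subseteq> {x \<in> X k. E k x = 0}"
      "indep_mod scaleC {0} F" by blast
    then show "b \<le> enat (card J)" using card_F by (simp only: enat_ord_simps)
  qed
  ultimately show ?thesis by (rule order_trans[rotated])
qed

section \<open>The equality of spectra, at one lambda and for the union\<close>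

lemma not_left_inv_diagonal_iff:
  assumes n: "1 \<le> n"
  shows "(\<exists>k\<in>{1..n}. \<not> left_inv scaleC norm (X k) (E k)) \<longleftrightarrow>
    \<not> left_inv dscal (dnorm n) V T \<or>
    (\<exists>k\<in>{2..n}. \<not> left_inv scaleC norm (X k) (E k) \<and>
      alpha scaleC (X k) (E k) \<le> (\<Sum>s\<in>{1..k-1}. beta scaleC (X s) (E s)))"
    (is "?L \<longleftrightarrow> \<not> ?T \<or> ?D")
proof
  assume ?L
  show "\<not> ?T \<or> ?D"
  proof (rule disjCI)
    assume "\<not> ?D"
    show "\<not> ?T"
    proof
      assume li: ?T
      obtain k where k: "k \<in> {1..n}" "\<not> left_inv scaleC norm (X k) (E k)" using \<open>?L\<close> by blast
      have "k \<noteq> 1" using left_inv_imp_left_inv_first[OF n li] k by auto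
      moreover have "alpha scaleC (X k) (E k) \<le> (\<Sum>s\<in>{1..k-1}. beta scaleC (X s) (E s))"
        using li by (intro alpha_le_sum_beta k(1))
          (auto simp: left_inv_def alpha_eq_0_iff[OF dscal_vector_space])
      ultimately show False using \<open>\<not> ?D\<close> k by auto
    qed
  qed
next
  assume "\<not> ?T \<or> ?D"
  then show ?L
  proof
    assume ?D
    then obtain k where "k \<in> {2..n}" "\<not> left_inv scaleC norm (X k) (E k)" by blast
    then show ?L by (intro bexI[of _ k]) auto
  qed (use left_inv_diagonal_imp_left_inv in blast)
qed

end

theorem mainTheorem13:
  fixes n :: nat
    and X :: "nat \<Rightarrow> 'h::complex_hilbert set"
    and D :: "nat \<Rightarrow> 'h \<Rightarrow> 'h"
  assumes n2: "n \<ge> 2"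
    and X_sub: "\<And>k. k \<in> {1..n} \<Longrightarrow> csubspace (X k) \<and> closed (X k)"
    and X_infdim: "\<And>k. k \<in> {1..n} \<Longrightarrow> ldim scaleC (X k) = \<infinity>"
    and D_bdd: "\<And>k. k \<in> {1..n} \<Longrightarrow> blin_on (X k) (X k) (D k)"
  defines "\<Delta> \<equiv> (\<Union>k\<in>{2..n}. {z \<in> sigma_l (X k) (D k).
              alpha scaleC (X k) (\<lambda>x. D k x - scaleC z x)
                \<le> (\<Sum>s\<in>{1..k-1}. beta scaleC (X s) (\<lambda>x. D s x - scaleC z x))})"
  shows "(\<forall>A. in_Bn n X A \<longrightarrow>
            (\<Union>k\<in>{1..n}. sigma_l (X k) (D k))
              = lspec dscal (dnorm n) (dsum X n) (Tmat n D A) \<union> \<Delta>)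
       \<and> (\<Delta> = {} \<longrightarrow> (\<forall>A. in_Bn n X A \<longrightarrow>
            (\<Union>k\<in>{1..n}. sigma_l (X k) (D k))
              = lspec dscal (dnorm n) (dsum X n) (Tmat n D A)))"
proof -
  have "(\<Union>k\<in>{1..n}. sigma_l (X k) (D k))
          = lspec dscal (dnorm n) (dsum X n) (Tmat n D A) \<union> \<Delta>" if A: "in_Bn n X A" for A
  proof (rule set_eqI)
    fix z
    \<comment> \<open>The difference of lambda and the given matrix is again upper triangular, with
      diagonal entries lambda - D_k and the entries -A_ij above them.\<close>
    define E where "E k x = scaleC z x - D k x" for k x
    define B where "B i j x = - A i j x" for i j x
    have E_blin: "blin_on (X k) (X k) (E k)" if k: "k \<in> {1..n}" for k
      unfolding E_def using X_sub[OF k] D_bdd[OF k] by (intro blin_on_scaleC_diff) auto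
    have B_blin: "in_Bn n X B"
      unfolding in_Bn_def B_def
    proof (intro allI impI)
      fix i j assume ij: "1 \<le> i \<and> i < j \<and> j \<le> n"
      then have "blin_on (X j) (X i) (A i j)" "csubspace (X i)"
        using A X_sub[of i] by (auto simp: in_Bn_def)
      then show "blin_on (X j) (X i) (\<lambda>x. - A i j x)" by (rule blin_on_uminus[rotated])
    qed
    interpret upper_triangular n X E B
      using X_sub E_blin B_blin by unfold_locales auto
    \<comment> \<open>Only on the direct sum: elsewhere \<open>dscal z x\<close> may have nonzero
      coordinates outside \<open>{1..n}\<close>, where \<open>T x\<close> is 0. Left invertibility
      depends only on the values on \<open>V\<close>.\<close>
    have T_eq: "dscal z x - Tmat n D A x = T x" if "x \<in> V" for x
      using that by (auto simp: fun_eq_iff Tmat_def dscal_def dsum_def E_def B_def sum_negf)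
    have lspec_T: "z \<in> lspec dscal (dnorm n) V (Tmat n D A) \<longleftrightarrow> \<not> left_inv dscal (dnorm n) V T"
      unfolding lspec_def mem_Collect_eq by (simp only: left_inv_cong[of V _ T, OF T_eq])
    have lspec_D: "z \<in> sigma_l (X k) (D k) \<longleftrightarrow> \<not> left_inv scaleC norm (X k) (E k)" for k
      by (simp add: lspec_def E_def[abs_def])
    have alpha_E: "alpha scaleC (X k) (\<lambda>x. D k x - scaleC z x) = alpha scaleC (X k) (E k)" for k
    proof -
      have "{x \<in> X k. D k x - scaleC z x = 0} = {x \<in> X k. E k x = 0}" by (auto simp: E_def)
      then show ?thesis by (simp only: alpha_def)
    qed
    have beta_E: "(\<Sum>s\<in>{1..k-1}. beta scaleC (X s) (\<lambda>x. D s x - scaleC z x))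
        = (\<Sum>s\<in>{1..k-1}. beta scaleC (X s) (E s))" if "k \<in> {2..n}" for k
    proof (rule sum.cong)
      fix s assume "s \<in> {1..k-1}"
      then have s: "s \<in> {1..n}" using that by auto
      \<comment> \<open>\<Delta> is formed with D_s - lambda, the negative of \<open>E s\<close>. By
        linearity on the subspace \<open>X s\<close> both have the same range, hence the same
        beta.\<close>
      have "(\<lambda>x. - E s x) ` X s = E s ` X s"
      proof -
        have "- E s x = E s (- x)" "- x \<in> X s" if "x \<in> X s" for x
          using blin_on_diff[OF E[OF s] X(1)[OF s] _ that, of 0] blin_on_0[OF E[OF s] X(1)[OF s]]
            subspace_neg[OF csubspace_imp_subspace[OF X(1)[OF s]] that]
            subspace_0[OF csubspace_imp_subspace[OF X(1)[OF s]]] by simp_all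
        then show ?thesis by (auto simp: image_iff) (metis minus_minus)+
      qed
      then show "beta scaleC (X s) (\<lambda>x. D s x - scaleC z x) = beta scaleC (X s) (E s)"
        by (simp add: beta_def E_def)
    qed simp
    have "z \<in> \<Delta> \<longleftrightarrow> (\<exists>k\<in>{2..n}. \<not> left_inv scaleC norm (X k) (E k) \<and>
        alpha scaleC (X k) (E k) \<le> (\<Sum>s\<in>{1..k-1}. beta scaleC (X s) (E s)))"
      by (simp only: \<Delta>_def UN_iff mem_Collect_eq lspec_D alpha_E beta_E cong: bex_cong)
    then show "z \<in> (\<Union>k\<in>{1..n}. sigma_l (X k) (D k)) \<longleftrightarrow>
        z \<in> lspec dscal (dnorm n) V (Tmat n D A) \<union> \<Delta>"
      using not_left_inv_diagonal_iff n2
      by (simp only: UN_iff Un_iff lspec_D lspec_T)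
  qed
  then show ?thesis by auto
qed

end
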